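(* Suppose that $f,g$ are slice-regular functions defined on a (spherically symmetric) neighbourhood of the closure of $U$, with associated holomorphic maps $F,G$. Suppose that, for each $z\in b\mathcal{U}$, $$|(\Phi\circ F)(z)-(\Phi\circ G)(z)|<|(\Phi\circ F)(z)|+|(\Phi\circ G)(z)|.$$ Then $f$ and $g$ have the same weighted number of zeros in $U$.
   Context: $\mathbb{H}$ is the algebra of quaternions with standard basis $1,i,j,k$, $\mathbb{S}=\{q\in\mathbb{H}: q^2=-1\}$, and $\iota$ is the imaginary unit of $\mathbb{C}$. $\mathcal{U}\subset\mathbb{C}\cong\mathbb{R}^2$ is an open domain (connected) invariant under complex conjugation, and $U=\{x+vy: x+\iota y\in\mathcal{U},\ v\in\mathbb{S}\}$; sets of this form are called spherically symmetric. Here $\mathcal{U}$ is bounded with piecewise $C^1$ boundary $b\mathcal{U}$. A (left) slice-regular function on a spherically symmetric set $U$ (associated with $\mathcal{U}$) is $f:U\to\mathbb{H}$ with $f(x+vy)=\alpha(x,y)+v\beta(x,y)$ for all $x+\iota y\in\mathcal{U}$, $v\in\mathbb{S}$, where $\alpha,\beta:\mathcal{U}\to\mathbb{H}$ are differentiable with $\alpha(x,-y)=\alpha(x,y)$, $\beta(x,-y)=-\beta(x,y)$, $\partial_x\alpha=\partial_y\beta$, $\partial_y\alpha=-\partial_x\beta$. Writing $\alpha=\alpha_0+\alpha_1i+\alpha_2j+\alpha_3k$ and $\beta=\beta_0+\beta_1i+\beta_2j+\beta_3k$ with real components, the associated holomorphic map is $F=(f_0,f_1,f_2,f_3):\mathcal{U}\to\mathbb{C}^4$,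 $f_m(x+\iota y)=\alpha_m(x,y)+\iota\beta_m(x,y)$ (similarly $G$ for $g$). Put $\Phi(z)=z_0^2+z_1^2+z_2^2+z_3^2$ on $\mathbb{C}^4$. The $\star$-product of slice-regular functions $f=\alpha+v\beta$ and $g=\gamma+v\delta$ is the slice-regular function $(f\star g)(x+vy)=(\alpha\gamma-\beta\delta)(x,y)+v(\alpha\delta+\beta\gamma)(x,y)$. Zeros and multiplicities ($f\not\equiv0$). A real zero $x$ (also called isolated) has multiplicity $n$ if $f(q)=(q-x)^n g(q)$ with $g$ slice-regular near $x$, $g(x)\ne 0$. For a non-real sphere $S=[x+vy]=\{x+wy: w\in\mathbb{S}\}$, $y\neq0$, one can write near $S$ $$f(q)=\big((q-x)^2+y^2\big)^{m}\,\tilde f(q),\qquad \tilde f=(q-p_1)\star\cdots\star(q-p_n)\star g,$$ with $m,n\ge 0$, $\tilde f$ slice-regular and not identically zero on $S$, $p_1,\dots,p_n\in S$, and $g$ slice-regular with no zero on $S$. If $m\geq1$, $S$ is a spherical zero of multiplicity $m$; if $n\ge1$, $S$ carries an isolated non-real zero (at $p_1$) of multiplicity $n$. If both occur, both are counted. If $f$ has $k$ isolated (real or non-real) zeros and $m$ spherical zeros in $U$, counted with multiplicities, its weighted number of zeros in $U$ is $k+2m$. *)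

theory Defs
  imports "HOL-Complex_Analysis.Complex_Analysis"
begin

text \<open>\<open>Quat a b c d\<close> is $a + b i + c j + d k$.\<close>

datatype quat = Quat (q0: real) (q1: real) (q2: real) (q3: real)

lemma quat_eq_iff: "a = b \<longleftrightarrow> q0 a = q0 b \<and> q1 a = q1 b \<and> q2 a = q2 b \<and> q3 a = q3 b"
  by (cases a; cases b) auto

instantiation quat :: ab_group_add
begin

definition zero_quat :: quat where
  "0 = Quat 0 0 0 0"

definition plus_quat :: "quat \<Rightarrow> quat \<Rightarrow> quat" where
  "a + b = Quat (q0 a + q0 b) (q1 a + q1 b) (q2 a + q2 b) (q3 a + q3 b)"

definition uminus_quat :: "quat \<Rightarrow> quat" where
  "- a = Quat (- q0 a) (- q1 a) (- q2 a) (- q3 a)"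

definition minus_quat :: "quat \<Rightarrow> quat \<Rightarrow> quat" where
  "a - b = Quat (q0 a - q0 b) (q1 a - q1 b) (q2 a - q2 b) (q3 a - q3 b)"

lemma quat_sel_additive [simp]:
  "q0 0 = 0" "q1 0 = 0" "q2 0 = 0" "q3 0 = 0"
  "q0 (a + b) = q0 a + q0 b" "q1 (a + b) = q1 a + q1 b"
  "q2 (a + b) = q2 a + q2 b" "q3 (a + b) = q3 a + q3 b"
  "q0 (- a) = - q0 a" "q1 (- a) = - q1 a" "q2 (- a) = - q2 a" "q3 (- a) = - q3 a"
  "q0 (a - b) = q0 a - q0 b" "q1 (a - b) = q1 a - q1 b"
  "q2 (a - b) = q2 a - q2 b" "q3 (a - b) = q3 a - q3 b"
  by (simp_all add: zero_quat_def plus_quat_def uminus_quat_def minus_quat_def)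

instance
  by standard (simp_all add: quat_eq_iff)

end

instantiation quat :: real_vector
begin

definition scaleR_quat :: "real \<Rightarrow> quat \<Rightarrow> quat" where
  "scaleR r a = Quat (r * q0 a) (r * q1 a) (r * q2 a) (r * q3 a)"

lemma quat_sel_scaleR [simp]:
  "q0 (scaleR r a) = r * q0 a" "q1 (scaleR r a) = r * q1 a"
  "q2 (scaleR r a) = r * q2 a" "q3 (scaleR r a) = r * q3 a"
  by (simp_all add: scaleR_quat_def)

instance
  by standard (simp_all add: quat_eq_iff algebra_simps)

end

instantiation quat :: real_algebra_1
begin

definition one_quat :: quat where
  "1 = Quat 1 0 0 0"

definition times_quat :: "quat \<Rightarrow> quat \<Rightarrow> quat" where
  "a * b = Quat
    (q0 a * q0 b - q1 a * q1 b - q2 a * q2 b - q3 a * q3 b)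
    (q0 a * q1 b + q1 a * q0 b + q2 a * q3 b - q3 a * q2 b)
    (q0 a * q2 b - q1 a * q3 b + q2 a * q0 b + q3 a * q1 b)
    (q0 a * q3 b + q1 a * q2 b - q2 a * q1 b + q3 a * q0 b)"

lemma quat_sel_mult [simp]:
  "q0 1 = 1" "q1 1 = 0" "q2 1 = 0" "q3 1 = 0"
  "q0 (a * b) = q0 a * q0 b - q1 a * q1 b - q2 a * q2 b - q3 a * q3 b"
  "q1 (a * b) = q0 a * q1 b + q1 a * q0 b + q2 a * q3 b - q3 a * q2 b"
  "q2 (a * b) = q0 a * q2 b - q1 a * q3 b + q2 a * q0 b + q3 a * q1 b"
  "q3 (a * b) = q0 a * q3 b + q1 a * q2 b - q2 a * q1 b + q3 a * q0 b"
  by (simp_all add: one_quat_def times_quat_def)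

instance
  by standard (simp_all add: quat_eq_iff algebra_simps)

end

instantiation quat :: real_inner
begin

definition inner_quat :: "quat \<Rightarrow> quat \<Rightarrow> real" where
  "inner a b = q0 a * q0 b + q1 a * q1 b + q2 a * q2 b + q3 a * q3 b"

definition norm_quat :: "quat \<Rightarrow> real" where
  "norm (a :: quat) = sqrt (inner a a)"

definition sgn_quat :: "quat \<Rightarrow> quat" where
  "sgn (a :: quat) = inverse (norm a) *\<^sub>R a"

definition dist_quat :: "quat \<Rightarrow> quat \<Rightarrow> real" where
  "dist (a :: quat) b = norm (a - b)"

definition uniformity_quat :: "(quat \<times> quat) filter" where
  "uniformity_quat = (INF e\<in>{0<..}. principal {(x, y). dist x y < e})"

definition open_quat :: "quat set \<Rightarrow> bool" where
  "open_quat S \<longleftrightarrow> (\<forall>x\<in>S. \<forall>\<^sub>F (x', y) in uniformity. x' = x \<longrightarrow> y \<in> S)"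

instance
proof
  fix a b c :: quat and r :: real and S :: "quat set"
  show "dist a b = norm (a - b)"
    by (rule dist_quat_def)
  show "sgn a = inverse (norm a) *\<^sub>R a"
    by (rule sgn_quat_def)
  show "(uniformity :: (quat \<times> quat) filter) = (INF e\<in>{0<..}. principal {(x, y). dist x y < e})"
    by (rule uniformity_quat_def)
  show "open S \<longleftrightarrow> (\<forall>x\<in>S. \<forall>\<^sub>F (x', y) in uniformity. x' = x \<longrightarrow> y \<in> S)"
    by (rule open_quat_def)
  show "inner a b = inner b a"
    by (simp add: inner_quat_def mult.commute)
  show "inner (a + b) c = inner a c + inner b c"
    by (simp add: inner_quat_def algebra_simps)
  show "inner (r *\<^sub>R a) b = r * inner a b"
    by (simp add: inner_quat_def algebra_simps)
  show "0 \<le> inner a a"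
    by (simp add: inner_quat_def)
  have "inner a a = (q0 a)\<^sup>2 + (q1 a)\<^sup>2 + (q2 a)\<^sup>2 + (q3 a)\<^sup>2"
    by (simp add: inner_quat_def power2_eq_square)
  then show "inner a a = 0 \<longleftrightarrow> a = 0"
    by (simp add: quat_eq_iff add_nonneg_eq_0_iff)
  show "norm a = sqrt (inner a a)"
    by (rule norm_quat_def)
qed

end

instantiation quat :: real_normed_div_algebra
begin

definition inverse_quat :: "quat \<Rightarrow> quat" where
  "inverse a = scaleR (inverse (inner a a)) (Quat (q0 a) (- q1 a) (- q2 a) (- q3 a))"

definition divide_quat :: "quat \<Rightarrow> quat \<Rightarrow> quat" where
  "divide_quat a b = a * inverse b"

instance
proof
  fix a b :: quat
  have *: "a \<noteq> 0 \<Longrightarrow> inner a a \<noteq> 0"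
    by simp
  have **: "inner a a *\<^sub>R (inverse a * a) = inner a a *\<^sub>R 1"
    "inner a a *\<^sub>R (a * inverse a) = inner a a *\<^sub>R 1" if "a \<noteq> 0"
    using *[OF that]
    by (simp_all add: inverse_quat_def)
       (simp_all add: inner_quat_def quat_eq_iff algebra_simps)
  show "a \<noteq> 0 \<Longrightarrow> inverse a * a = 1" "a \<noteq> 0 \<Longrightarrow> a * inverse a = 1"
    using * ** by (auto simp only: scaleR_cancel_left)
  show "a div b = a * inverse b"
    by (rule divide_quat_def)
  show "inverse (0 :: quat) = 0"
    by (simp add: inverse_quat_def quat_eq_iff)
  have "inner (a * b) (a * b) = inner a a * inner b b"
    by (simp add: inner_quat_def algebra_simps)
  then show "norm (a * b) = norm a * norm b"
    by (simp add: norm_quat_def real_sqrt_mult)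
qed

end

definition unit_imag :: "quat set"  (\<open>\<S>\<close>) where
  "\<S> = {q. q\<^sup>2 = -1}"

definition conj_invariant :: "complex set \<Rightarrow> bool" where
  "conj_invariant W \<longleftrightarrow> (\<forall>z\<in>W. cnj z \<in> W)"

definition slice_pt :: "complex \<Rightarrow> quat \<Rightarrow> quat" where
  "slice_pt z v = of_real (Re z) + v * of_real (Im z)"

definition sph :: "complex set \<Rightarrow> quat set" where
  "sph W = {slice_pt z v | z v. z \<in> W \<and> v \<in> \<S>}"

definition partial_x :: "(complex \<Rightarrow> quat) \<Rightarrow> complex \<Rightarrow> quat" where
  "partial_x h z = vector_derivative (\<lambda>t. h (Complex t (Im z))) (at (Re z))"

definition partial_y :: "(complex \<Rightarrow> quat) \<Rightarrow> complex \<Rightarrow> quat" where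
  "partial_y h z = vector_derivative (\<lambda>t. h (Complex (Re z) t)) (at (Im z))"

text \<open>
  \<open>f\<close> is slice-regular on \<open>sph W\<close> with $f(x + vy) = \alpha(x,y) + v\,\beta(x,y)$, the pair $(x,y)$
  being encoded as the complex number $x + \iota y$.  The functions are total; only the values of
  \<open>f\<close> on \<open>sph W\<close> and of \<open>\<alpha>\<close>, \<open>\<beta>\<close> on the open set \<open>W\<close> are constrained, and there \<open>f\<close>
  determines \<open>\<alpha>\<close> and \<open>\<beta>\<close>.  Connectedness of \<open>W\<close> is not part of the predicate, because the
  local factorisations below live near a non-real sphere, that is, near a pair of conjugate points.
\<close>

definition slice_regular_with ::
    "complex set \<Rightarrow> (quat \<Rightarrow> quat) \<Rightarrow> (complex \<Rightarrow> quat) \<Rightarrow> (complex \<Rightarrow> quat) \<Rightarrow> bool" where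
  "slice_regular_with W f \<alpha> \<beta> \<longleftrightarrow>
     open W \<and> conj_invariant W \<and>
     (\<forall>z\<in>W. \<forall>v\<in>\<S>. f (slice_pt z v) = \<alpha> z + v * \<beta> z) \<and>
     (\<forall>z\<in>W. \<alpha> differentiable (at z) \<and> \<beta> differentiable (at z) \<and>
            \<alpha> (cnj z) = \<alpha> z \<and> \<beta> (cnj z) = - \<beta> z \<and>
            partial_x \<alpha> z = partial_y \<beta> z \<and> partial_y \<alpha> z = - partial_x \<beta> z)"

definition slice_regular :: "complex set \<Rightarrow> (quat \<Rightarrow> quat) \<Rightarrow> bool" where
  "slice_regular W f \<longleftrightarrow> (\<exists>\<alpha> \<beta>. slice_regular_with W f \<alpha> \<beta>)"

definition assoc_map :: "(complex \<Rightarrow> quat) \<Rightarrow> (complex \<Rightarrow> quat) \<Rightarrow> complex \<Rightarrow> complex ^ 4" where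
  "assoc_map \<alpha> \<beta> z = vector
     [Complex (q0 (\<alpha> z)) (q0 (\<beta> z)), Complex (q1 (\<alpha> z)) (q1 (\<beta> z)),
      Complex (q2 (\<alpha> z)) (q2 (\<beta> z)), Complex (q3 (\<alpha> z)) (q3 (\<beta> z))]"

definition Phi :: "complex ^ 4 \<Rightarrow> complex"  (\<open>\<Phi>\<close>) where
  "\<Phi> z = (\<Sum>l\<in>UNIV. (z $ l)\<^sup>2)"

text \<open>\<open>h\<close> is the \<open>\<star>\<close>-product of \<open>f\<close> and \<open>g\<close> on \<open>sph W\<close>.\<close>

definition is_star_product ::
    "complex set \<Rightarrow> (quat \<Rightarrow> quat) \<Rightarrow> (quat \<Rightarrow> quat) \<Rightarrow> (quat \<Rightarrow> quat) \<Rightarrow> bool" where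
  "is_star_product W f g h \<longleftrightarrow>
     (\<exists>\<alpha> \<beta> \<gamma> \<delta>. slice_regular_with W f \<alpha> \<beta> \<and> slice_regular_with W g \<gamma> \<delta> \<and>
        (\<forall>z\<in>W. \<forall>v\<in>\<S>. h (slice_pt z v) =
           (\<alpha> z * \<gamma> z - \<beta> z * \<delta> z) + v * (\<alpha> z * \<delta> z + \<beta> z * \<gamma> z)))"

text \<open>\<open>h\<close> is $(q - p_1) \star \cdots \star (q - p_n) \star g$ on \<open>sph W\<close>, where
  $p_1, \dots, p_n$ is the given list.\<close>

fun is_linear_star_product ::
    "complex set \<Rightarrow> quat list \<Rightarrow> (quat \<Rightarrow> quat) \<Rightarrow> (quat \<Rightarrow> quat) \<Rightarrow> bool" where
  "is_linear_star_product W [] g h \<longleftrightarrow> (\<forall>q\<in>sph W. h q = g q)"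
| "is_linear_star_product W (p # ps) g h \<longleftrightarrow>
     (\<exists>h'. is_linear_star_product W ps g h' \<and> is_star_product W (\<lambda>q. q - p) h' h)"

definition real_zero_mult :: "(quat \<Rightarrow> quat) \<Rightarrow> real \<Rightarrow> nat \<Rightarrow> bool" where
  "real_zero_mult f x n \<longleftrightarrow>
     (\<exists>W g. of_real x \<in> W \<and> slice_regular W g \<and> g (of_real x) \<noteq> 0 \<and>
        (\<forall>q\<in>sph W. f q = (q - of_real x) ^ n * g q))"

text \<open>
  \<open>sphere_mults f z m n\<close>: on the non-real sphere $S = [x + vy]$ with $z = x + \iota y$, \<open>m\<close> is the
  exponent of $(q - x)^2 + y^2$ and \<open>n\<close> the number of linear factors in the local factorisation of
  \<open>f\<close>.  So \<open>m\<close> is the multiplicity of \<open>S\<close> as a spherical zero and \<open>n\<close> that of the isolated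
  non-real zero on \<open>S\<close>, the value \<open>0\<close> meaning that there is no such zero.
\<close>

definition sphere_mults :: "(quat \<Rightarrow> quat) \<Rightarrow> complex \<Rightarrow> nat \<Rightarrow> nat \<Rightarrow> bool" where
  "sphere_mults f z m n \<longleftrightarrow> Im z \<noteq> 0 \<and>
     (\<exists>W f' ps g. z \<in> W \<and> slice_regular W f' \<and> slice_regular W g \<and>
        (\<forall>q\<in>sph W. f q = ((q - of_real (Re z))\<^sup>2 + of_real ((Im z)\<^sup>2)) ^ m * f' q) \<and>
        (\<exists>q\<in>sph {z}. f' q \<noteq> 0) \<and>
        length ps = n \<and> set ps \<subseteq> sph {z} \<and> is_linear_star_product W ps g f' \<and>
        (\<forall>q\<in>sph {z}. g q \<noteq> 0))"

definition real_zeros :: "complex set \<Rightarrow> (quat \<Rightarrow> quat) \<Rightarrow> real set" where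
  "real_zeros U f = {x. of_real x \<in> U \<and> f (of_real x) = 0}"

text \<open>The non-real spheres carrying a zero of \<open>f\<close>; as \<open>z\<close> and \<open>cnj z\<close> give the same sphere,
  each is represented by its unique \<open>z\<close> in the upper half plane.\<close>

definition zero_spheres :: "complex set \<Rightarrow> (quat \<Rightarrow> quat) \<Rightarrow> complex set" where
  "zero_spheres U f = {z \<in> U. Im z > 0 \<and> (\<exists>q\<in>sph {z}. f q = 0)}"

text \<open>
  \<open>f\<close> has finitely many isolated and spherical zeros in \<open>sph U\<close>, and $N = k + 2m$ where $k$ and
  $m$ are the numbers of isolated (real or non-real) and of spherical zeros, counted with
  multiplicities.
\<close>

definition has_weighted_number :: "complex set \<Rightarrow> (quat \<Rightarrow> quat) \<Rightarrow> nat \<Rightarrow> bool" where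
  "has_weighted_number U f N \<longleftrightarrow>
     finite (real_zeros U f) \<and> finite (zero_spheres U f) \<and>
     (\<exists>\<rho> \<mu> \<nu>.
        (\<forall>x\<in>real_zeros U f. real_zero_mult f x (\<rho> x)) \<and>
        (\<forall>z\<in>zero_spheres U f. sphere_mults f z (\<mu> z) (\<nu> z)) \<and>
        N = ((\<Sum>x\<in>real_zeros U f. \<rho> x) + (\<Sum>z\<in>zero_spheres U f. \<nu> z))
            + 2 * (\<Sum>z\<in>zero_spheres U f. \<mu> z))"

definition symmetric_domain :: "complex set \<Rightarrow> bool" where
  "symmetric_domain U \<longleftrightarrow> open U \<and> connected U \<and> U \<noteq> {} \<and> conj_invariant U"

text \<open>The boundary consists of finitely many piecewise $C^1$ Jordan curves, which may touch.\<close>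

definition piecewise_C1_boundary :: "complex set \<Rightarrow> bool" where
  "piecewise_C1_boundary U \<longleftrightarrow>
     (\<exists>\<Gamma>. finite \<Gamma> \<and>
        (\<forall>c\<in>\<Gamma>. simple_path c \<and> valid_path c \<and> pathfinish c = pathstart c) \<and>
        frontier U = (\<Union>c\<in>\<Gamma>. path_image c))"

end

theory Submission
  imports Defs
begin

text \<open>
Write $F = \alpha + \iota\beta$ for the map $\mathbb{C} \supseteq V \to \mathbb{H} \otimes
\mathbb{C} = \mathbb{C}^4$ associated with $f$.  It is holomorphic, satisfies
$F(\bar z) = \overline{F(z)}$, and turns the $\star$-product into the product of complexified
quaternions.  The quadratic form $\Phi$ is the norm form of that algebra, so it is multiplicative,
and $\phi = \Phi \circ F$ is a holomorphic function on $V$ whose zeros see all the zeros of $f$: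
$\Phi(a + \iota b) = 0$ exactly when $a + vb = 0$ for some imaginary unit $v$ (lemma
\<open>Phi_eq_0_iff\<close>).

The multiplicities are read off in the same way.  A factor $(q - x)^n$ with $x$ real multiplies
$\phi$ by $(w - x)^{2n}$.  On a non-real sphere $[x + vy]$, with $z = x + \iota y$, each factor
$(q - x)^2 + y^2$ multiplies $\phi$ by $((w - z)(w - \bar z))^2$, and each factor $q - p_i$ only by
$(w - z)(w - \bar z)$.  Hence $\phi$ has order $2n$ at a real zero of multiplicity $n$ and order
$2m + n$ at both $z$ and $\bar z$ (lemmas \<open>real_zero_mult_zorder\<close> and
\<open>sphere_mults_zorder\<close>); summing up, the number of zeros of $\phi$ in $U$ is twice the
weighted number of zeros of $f$, whatever factorisations are chosen (lemma
\<open>weighted_number_zero_count\<close>).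

That factorisations exist is shown by dividing $F$ as long as possible: componentwise by $w - x$ or
$(w - z)(w - \bar z)$ when $F$ vanishes at the point (lemma \<open>stem_exhaust_factor\<close>), and by
the left factor $w - p$ when only $\Phi \circ F$ vanishes (lemma
\<open>linear_factorisation_exists\<close>).  Each division lowers the order of $\phi$, so the process
stops.

It remains to compare the numbers of zeros of $\Phi \circ F$ and $\Phi \circ G$ in $U$, which is the
symmetric form of Rouche's theorem (theorem \<open>symmetric_rouche\<close>).  The strict inequality
keeps the segment $(1-t)\,\Phi \circ F + t\,\Phi \circ G$ free of zeros on the frontier of $U$, and
the number of zeros in $U$ is then locally constant in $t$, because near each zero the classical
theorem applies on a small circle.
\<close>

(* Coefficients of power series and components of vectors share the symbol $; only the latter occur
   here, and leaving both readings open makes long products of components expensive to parse. *)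
no_notation fps_nth (infixl \<open>$\<close> 75)

section \<open>Counting zeros in a bounded open set\<close>

text \<open>
The zeros are counted with multiplicity.  The value is meaningful when there are finitely many of
them and the function is holomorphic, so that all orders are positive.
\<close>

definition zero_count :: "(complex \<Rightarrow> complex) \<Rightarrow> complex set \<Rightarrow> int" where
  "zero_count f U = (\<Sum>p\<in>{p\<in>U. f p = 0}. zorder f p)"

lemma finite_zeros_compact:
  assumes "f holomorphic_on S" "open S" "connected S" "compact K" "K \<subseteq> S" "w \<in> S" "f w \<noteq> 0"
  shows "finite {z \<in> K. f z = 0}"
proof (cases "f constant_on S")
  case True
  then obtain c where "\<And>z. z \<in> S \<Longrightarrow> f z = c"
    by (auto simp: constant_on_def)
  with assms have "{z \<in> K. f z = 0} = {}"
    by (metis (mono_tags, lifting) empty_Collect_eq subsetD)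
  then show ?thesis by (simp only: finite.emptyI)
next
  case False
  then show ?thesis
    using assms holomorphic_compact_finite_zeros by blast
qed

text \<open>
The classical theorem on a circle: after shrinking the domain to a disc slightly larger than the
closed one, the winding number is $1$ at the zeros inside and $0$ at those outside.
\<close>

lemma rouche_ball:
  assumes holf: "f holomorphic_on W" and holg: "g holomorphic_on W" and "open W"
    and r: "0 < r" "cball a r \<subseteq> W"
    and less: "\<And>z. z \<in> sphere a r \<Longrightarrow> cmod (g z - f z) < cmod (f z)"
  shows "finite {p \<in> ball a r. g p = 0}"
    and "zero_count g (ball a r) = zero_count f (ball a r)"
proof -
  (* The distance from the centre to the complement of W is attained, hence larger than r. *)
  obtain e where e: "e > 0" and big: "ball a (r + e) \<subseteq> W"
  proof (cases "W = UNIV")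
    case True
    then show ?thesis using that[of 1] by simp
  next
    case False
    then obtain y where y: "y \<in> - W" "\<And>x. x \<in> - W \<Longrightarrow> dist a y \<le> dist a x"
      using distance_attains_inf[of "- W" a] \<open>open W\<close> by (auto simp: closed_def)
    then have "dist a y > r"
      using r(2) by force
    moreover have "ball a (dist a y) \<subseteq> W"
      using y(2) by force
    ultimately show ?thesis
      using that[of "dist a y - r"] by simp
  qed
  define S where "S = ball a (r + e / 2)"
  have S: "open S" "connected S" "S \<subseteq> ball a (r + e)" "S \<subseteq> cball a (r + e/2)"
    "cball a (r + e/2) \<subseteq> ball a (r + e)" "cball a r \<subseteq> S"
    using e r by (auto simp: S_def)
  obtain w where w: "w \<in> sphere a r"
    using r(1) that[of "a + of_real r"] by (simp add: dist_norm)
  then have nz: "f w \<noteq> 0" "g w \<noteq> 0" and wS: "w \<in> ball a (r + e)"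
    using less[OF w] e by auto
  have fin: "finite {p \<in> S. h p = 0}" if "h holomorphic_on W" "h w \<noteq> 0" for h
  proof -
    have "finite {p \<in> cball a (r + e/2). h p = 0}"
      using that big S wS
      by (intro finite_zeros_compact[of h "ball a (r + e)"]) (auto intro: holomorphic_on_subset)
    then show ?thesis
      using S(4) by (elim rev_finite_subset) auto
  qed
  show "finite {p \<in> ball a r. g p = 0}"
    using fin[OF holg nz(2)] S(6) by (elim rev_finite_subset) force
  have weighted: "(\<Sum>p\<in>{p\<in>S. h p = 0}. winding_number (circlepath a r) p * zorder h p)
      = of_int (zero_count h (ball a r))"
    if h: "h holomorphic_on W" and hnz: "\<And>z. z \<in> sphere a r \<Longrightarrow> h z \<noteq> 0" for h
  proof -
    have "(\<Sum>p\<in>{p\<in>S. h p = 0}. winding_number (circlepath a r) p * zorder h p)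
        = (\<Sum>p\<in>{p\<in>ball a r. h p = 0}. winding_number (circlepath a r) p * zorder h p)"
    proof (rule sum.mono_neutral_right)
      show "finite {p\<in>S. h p = 0}" using fin[OF h hnz[OF w]] .
      show "{p\<in>ball a r. h p = 0} \<subseteq> {p\<in>S. h p = 0}" using S(6) by force
      show "\<forall>p\<in>{p \<in> S. h p = 0} - {p \<in> ball a r. h p = 0}.
              winding_number (circlepath a r) p * zorder h p = 0"
      proof
        fix p assume "p \<in> {p \<in> S. h p = 0} - {p \<in> ball a r. h p = 0}"
        with hnz[of p] have "p \<notin> cball a r" by force
        then have "winding_number (circlepath a r) p = 0"
          using r by (intro winding_number_zero_outside[of _ "cball a r"]) auto
        then show "winding_number (circlepath a r) p * zorder h p = 0" by simp
      qed
    qed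
    also have "\<dots> = (\<Sum>p\<in>{p\<in>ball a r. h p = 0}. of_int (zorder h p))"
      by (intro sum.cong) (auto simp: winding_number_circlepath dist_norm norm_minus_commute)
    finally show ?thesis
      by (simp add: zero_count_def)
  qed
  have eq: "f p + (g p - f p) = g p" for p by simp
  have holS: "f holomorphic_on S" "(\<lambda>p. g p - f p) holomorphic_on S"
    using S(3) big holf holg by (auto intro!: holomorphic_intros intro: holomorphic_on_subset)
  have "(\<Sum>p\<in>{p\<in>S. g p = 0}. winding_number (circlepath a r) p * zorder g p)
      = (\<Sum>p\<in>{p\<in>S. f p = 0}. winding_number (circlepath a r) p * zorder f p)"
  proof (rule Rouche_theorem[of S f "\<lambda>p. g p - f p" "circlepath a r", unfolded eq])
    show "\<forall>z. z \<notin> S \<longrightarrow> winding_number (circlepath a r) z = 0"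
      using S(6) r by (auto intro!: winding_number_zero_outside[of _ "cball a r"])
    show "\<forall>z\<in>path_image (circlepath a r). cmod (g z - f z) < cmod (f z)"
      using less r by simp
    show "path_image (circlepath a r) \<subseteq> S"
      using S(6) r by auto
    show "finite {p \<in> S. g p = 0}" "finite {p \<in> S. f p = 0}"
      using fin holf holg nz by auto
  qed (use S holS in auto)
  moreover have nz_sphere: "g z \<noteq> 0" "f z \<noteq> 0" if "z \<in> sphere a r" for z
    using less[OF that] by auto
  ultimately have "of_int (zero_count g (ball a r)) = (of_int (zero_count f (ball a r)) :: complex)"
    by (simp only: weighted[OF holf nz_sphere(2)] weighted[OF holg nz_sphere(1)])
  then show "zero_count g (ball a r) = zero_count f (ball a r)"
    by simp
qed

text \<open>
A zero-free frontier confines the zeros to finitely many small discs inside $U$.  The modulus of $f$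
is bounded below on the compact rest of the closure, which contains the bounding circles; a
perturbation below that bound creates no zeros outside the discs and moves none across a circle.
\<close>

lemma zero_count_stable:
  assumes holf: "f holomorphic_on V" and "open V" and U: "open U" "bounded U" "closure U \<subseteq> V"
    and nz: "\<And>z. z \<in> frontier U \<Longrightarrow> f z \<noteq> 0" and fin: "finite {z \<in> U. f z = 0}"
  obtains d where "d > 0"
    "\<And>g. g holomorphic_on V \<Longrightarrow> (\<And>z. z \<in> closure U \<Longrightarrow> cmod (g z - f z) < d)
       \<Longrightarrow> zero_count g U = zero_count f U"
proof -
  define Z where "Z = {z \<in> U. f z = 0}"
  have "\<exists>e>0. \<forall>w\<in>cball z e. w \<in> U \<and> (w \<noteq> z \<longrightarrow> w \<notin> Z)" if "z \<in> Z" for z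
    using finite_cball_avoid[OF U(1), of Z z] fin that by (auto simp: Z_def)
  then obtain e where e: "\<And>z. z \<in> Z \<Longrightarrow> e z > 0"
    "\<And>z w. z \<in> Z \<Longrightarrow> w \<in> cball z (e z) \<Longrightarrow> w \<in> U \<and> (w \<noteq> z \<longrightarrow> w \<notin> Z)"
    by metis
  (* Each disc of radius e z contains no other zero, so halving the radii makes the discs disjoint. *)
  define r where "r z = e z / 2" for z
  have r: "r z > 0" "cball z (r z) \<subseteq> U" if "z \<in> Z" for z
    using e[OF that] by (auto simp: r_def)
  have disj: "cball z (r z) \<inter> cball z' (r z') = {}" if "z \<in> Z" "z' \<in> Z" "z \<noteq> z'" for z z'
  proof (rule ccontr)
    assume "cball z (r z) \<inter> cball z' (r z') \<noteq> {}"
    then obtain w where "dist z w \<le> r z" "dist z' w \<le> r z'" by auto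
    then have "dist z z' \<le> e z / 2 + e z' / 2"
      using dist_triangle2[of z z' w] by (simp add: r_def)
    then have "dist z z' \<le> e z \<or> dist z' z \<le> e z'"
      by (simp add: dist_commute) linarith
    then have "z' \<in> cball z (e z) \<or> z \<in> cball z' (e z')"
      by simp
    then show False
      using e(2) that by blast
  qed
  define C where "C = closure U - (\<Union>z\<in>Z. ball z (r z))"
  have "compact C"
    unfolding C_def using U(2) by (intro compact_diff) (auto simp: compact_closure)
  have fC: "f z \<noteq> 0" if "z \<in> C" for z
  proof (cases "z \<in> U")
    case True
    then show ?thesis using that r(1)[of z] by (auto simp: C_def Z_def)
  next
    case False
    then show ?thesis using that U(1) nz by (auto simp: C_def frontier_def interior_open)
  qed
  have contf: "continuous_on C f"
    using holf U(3) by (auto simp: C_def intro: holomorphic_on_imp_continuous_on holomorphic_on_subset)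
  obtain d where d: "d > 0" "\<And>z. z \<in> C \<Longrightarrow> d \<le> cmod (f z)"
  proof (cases "C = {}")
    case True
    then show ?thesis using that[of 1] by auto
  next
    case False
    have "continuous_on C (\<lambda>z. cmod (f z))"
      by (intro continuous_intros contf)
    then obtain x where "x \<in> C" "\<And>z. z \<in> C \<Longrightarrow> cmod (f x) \<le> cmod (f z)"
      using continuous_attains_inf[OF \<open>compact C\<close> False] by blast
    then show ?thesis using that[of "cmod (f x)"] fC by auto
  qed
  have sphereC: "sphere z (r z) \<subseteq> C" if "z \<in> Z" for z
  proof
    fix x assume x: "x \<in> sphere z (r z)"
    then have "x \<in> cball z (r z)" by simp
    moreover have "x \<notin> ball z' (r z')" if "z' \<in> Z" for z'
    proof (cases "z' = z")
      case True
      then show ?thesis using x by simp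
    next
      case False
      then have "cball z (r z) \<inter> cball z' (r z') = {}"
        using disj[OF \<open>z \<in> Z\<close> that] by simp
      moreover have "x \<in> cball z (r z)" using x by simp
      ultimately have "x \<notin> cball z' (r z')" by blast
      then show ?thesis by simp
    qed
    ultimately show "x \<in> C"
      using r(2)[OF \<open>z \<in> Z\<close>] closure_subset[of U] by (auto simp: C_def)
  qed
  have split: "zero_count h U = (\<Sum>z\<in>Z. zero_count h (ball z (r z)))"
    if hnz: "\<And>z. z \<in> C \<Longrightarrow> h z \<noteq> 0"
      and fin_h: "\<And>z. z \<in> Z \<Longrightarrow> finite {p \<in> ball z (r z). h p = 0}" for h
  proof -
    have eq: "{p \<in> U. h p = 0} = (\<Union>z\<in>Z. {p \<in> ball z (r z). h p = 0})"
    proof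
      show "{p \<in> U. h p = 0} \<subseteq> (\<Union>z\<in>Z. {p \<in> ball z (r z). h p = 0})"
        using hnz closure_subset[of U] by (auto simp: C_def)
      show "(\<Union>z\<in>Z. {p \<in> ball z (r z). h p = 0}) \<subseteq> {p \<in> U. h p = 0}"
        using r(2) by force
    qed
    show ?thesis
      unfolding zero_count_def eq
    proof (rule sum.UNION_disjoint)
      show "finite Z" using fin by (simp add: Z_def)
      show "\<forall>z\<in>Z. finite {p \<in> ball z (r z). h p = 0}" using fin_h by blast
      show "\<forall>z\<in>Z. \<forall>z'\<in>Z. z \<noteq> z' \<longrightarrow>
              {p \<in> ball z (r z). h p = 0} \<inter> {p \<in> ball z' (r z'). h p = 0} = {}"
      proof (intro ballI impI)
        fix z z' assume zz: "z \<in> Z" "z' \<in> Z" "z \<noteq> z'"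
        have "ball z (r z) \<inter> ball z' (r z') = {}"
          using disj[OF zz] ball_subset_cball by blast
        then show "{p \<in> ball z (r z). h p = 0} \<inter> {p \<in> ball z' (r z'). h p = 0} = {}"
          by blast
      qed
    qed
  qed
  have local: "finite {p \<in> ball z (r z). g p = 0}"
    "zero_count g (ball z (r z)) = zero_count f (ball z (r z))"
    if "g holomorphic_on V" "\<And>z. z \<in> closure U \<Longrightarrow> cmod (g z - f z) < d" "z \<in> Z" for g z
  proof -
    have sub: "cball z (r z) \<subseteq> V"
      using r(2)[OF that(3)] U(3) closure_subset[of U] by blast
    have "cmod (g w - f w) < cmod (f w)" if "w \<in> sphere z (r z)" for w
    proof -
      have "w \<in> C" using sphereC \<open>z \<in> Z\<close> that by blast
      then show ?thesis
        using d(2)[of w] \<open>\<And>z. z \<in> closure U \<Longrightarrow> cmod (g z - f z) < d\<close>[of w] by (auto simp: C_def)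
    qed
    then show "finite {p \<in> ball z (r z). g p = 0}"
      "zero_count g (ball z (r z)) = zero_count f (ball z (r z))"
      using rouche_ball[OF holf that(1) \<open>open V\<close> r(1)[OF that(3)] sub] by blast+
  qed
  show ?thesis
  proof (rule that[OF d(1)])
    fix g assume g: "g holomorphic_on V" "\<And>z. z \<in> closure U \<Longrightarrow> cmod (g z - f z) < d"
    have "g z \<noteq> 0" if "z \<in> C" for z
      using g(2)[of z] d(2)[OF that] that by (auto simp: C_def)
    then have "zero_count g U = (\<Sum>z\<in>Z. zero_count g (ball z (r z)))"
      using local(1)[OF g] by (intro split)
    also have "\<dots> = (\<Sum>z\<in>Z. zero_count f (ball z (r z)))"
      using local(2)[OF g] by (intro sum.cong) auto
    also have "\<dots> = zero_count f U"
      using local(1)[OF holf] d(1) fC by (intro split[symmetric]) auto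
    finally show "zero_count g U = zero_count f U" .
  qed
qed

text \<open>
Connectedness of $[0,1]$ turns local constancy along the segment from $f$ to $g$ into equality at
its ends.
\<close>

theorem symmetric_rouche:
  assumes holf: "f holomorphic_on V" and holg: "g holomorphic_on V" and V: "open V" "connected V"
    and U: "open U" "bounded U" "U \<noteq> {}" "closure U \<subseteq> V"
    and less: "\<And>z. z \<in> frontier U \<Longrightarrow> cmod (f z - g z) < cmod (f z) + cmod (g z)"
  shows "zero_count f U = zero_count g U"
proof -
  define h where "h t z = f z + of_real t * (g z - f z)" for t :: real and z
  have compU: "compact (closure U)"
    using U(2) by (simp add: compact_closure)
  obtain w where w: "w \<in> frontier U"
    using frontier_eq_empty[of U] U(2,3) not_bounded_UNIV by blast
  then have wV: "w \<in> V"
    using U(4) by (auto simp: frontier_def)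
  have holh: "h t holomorphic_on V" for t
    unfolding h_def by (intro holomorphic_intros holf holg)
  have nz: "h t z \<noteq> 0" if "t \<in> {0..1}" "z \<in> frontier U" for t z
  proof
    (* At a zero on the segment, 0 lies between f z and g z, so their distance is the sum of the moduli. *)
    assume "h t z = 0"
    then have eqs: "f z = of_real t * (f z - g z)" "g z = - (of_real (1 - t) * (f z - g z))"
      by (auto simp: h_def algebra_simps)
    have t: "\<bar>t\<bar> = t" "\<bar>1 - t\<bar> = 1 - t"
      using that(1) by auto
    have "cmod (f z) = t * cmod (f z - g z)"
      using arg_cong[OF eqs(1), of cmod] t by (simp add: norm_mult)
    moreover have "cmod (g z) = (1 - t) * cmod (f z - g z)"
      using arg_cong[OF eqs(2), of cmod] t by (simp add: norm_mult del: of_real_diff)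
    ultimately have "cmod (f z) + cmod (g z) = cmod (f z - g z)"
      by (simp add: algebra_simps)
    then show False
      using less[OF that(2)] by simp
  qed
  obtain M where M: "M > 0" "\<And>z. z \<in> closure U \<Longrightarrow> cmod (g z - f z) \<le> M"
  proof -
    have "continuous_on (closure U) (\<lambda>z. g z - f z)"
      using holf holg U(4) by (intro continuous_intros holomorphic_on_imp_continuous_on)
        (auto intro: holomorphic_on_subset)
    then have "bounded ((\<lambda>z. g z - f z) ` closure U)"
      by (intro compact_imp_bounded compact_continuous_image compU)
    then show ?thesis
      using that unfolding bounded_pos by blast
  qed
  have "(\<lambda>t. zero_count (h t) U) constant_on {0..1}"
  proof (rule locally_constant_imp_constant)
    fix a :: real assume a: "a \<in> {0..1}"
    have "finite {z \<in> closure U. h a z = 0}"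
      using finite_zeros_compact[OF holh V compU U(4) wV nz[OF a w]] .
    then have fin: "finite {z \<in> U. h a z = 0}"
      by (rule rev_finite_subset) (use closure_subset[of U] in auto)
    obtain d where d: "d > 0"
      "\<And>k. k holomorphic_on V \<Longrightarrow> (\<And>z. z \<in> closure U \<Longrightarrow> cmod (k z - h a z) < d)
         \<Longrightarrow> zero_count k U = zero_count (h a) U"
      using zero_count_stable[OF holh[of a] V(1) U(1,2,4) nz[OF a] fin] by blast
    show "\<exists>T. openin (top_of_set {0..1}) T \<and> a \<in> T
            \<and> (\<forall>t\<in>T. zero_count (h t) U = zero_count (h a) U)"
    proof (intro exI[of _ "{0..1} \<inter> ball a (d / M)"] conjI ballI)
      show "openin (top_of_set {0..1}) ({0..1} \<inter> ball a (d / M))"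
        by (simp add: openin_open_Int)
      show "a \<in> {0..1} \<inter> ball a (d / M)"
        using a d M by simp
      fix t assume t: "t \<in> {0..1} \<inter> ball a (d / M)"
      show "zero_count (h t) U = zero_count (h a) U"
      proof (rule d(2)[OF holh])
        fix z assume z: "z \<in> closure U"
        have "h t z - h a z = of_real (t - a) * (g z - f z)"
          by (simp add: h_def algebra_simps)
        then have "cmod (h t z - h a z) = \<bar>t - a\<bar> * cmod (g z - f z)"
          by (simp add: norm_mult del: of_real_diff)
        also have "\<dots> \<le> \<bar>t - a\<bar> * M"
          using M(2)[OF z] by (intro mult_left_mono) auto
        also have "\<dots> < d"
          using t M(1) by (simp add: dist_real_def abs_minus_commute pos_less_divide_eq)
        finally show "cmod (h t z - h a z) < d" .
      qed
    qed
  qed simp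
  then have "zero_count (h 0) U = zero_count (h 1) U"
    by (force simp: constant_on_def)
  moreover have "h 0 = f" "h 1 = g"
    by (auto simp: h_def)
  ultimately show ?thesis by simp
qed

section \<open>Slices and the imaginary sphere\<close>

lemma unit_imag_iff:
  "v \<in> \<S> \<longleftrightarrow> q0 v = 0 \<and> (q1 v)\<^sup>2 + (q2 v)\<^sup>2 + (q3 v)\<^sup>2 = 1"
proof
  assume "v \<in> \<S>"
  then have eqs: "q0 v * q0 v - q1 v * q1 v - q2 v * q2 v - q3 v * q3 v = -1"
    "q0 v * q1 v = 0" "q0 v * q2 v = 0" "q0 v * q3 v = 0"
    by (simp_all add: unit_imag_def power2_eq_square quat_eq_iff)
  have "q0 v = 0"
  proof (rule ccontr)
    assume "q0 v \<noteq> 0"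
    with eqs have "q0 v * q0 v = -1" by simp
    then show False using zero_le_square[of "q0 v"] by linarith
  qed
  with eqs show "q0 v = 0 \<and> (q1 v)\<^sup>2 + (q2 v)\<^sup>2 + (q3 v)\<^sup>2 = 1"
    by (simp add: power2_eq_square)
next
  assume "q0 v = 0 \<and> (q1 v)\<^sup>2 + (q2 v)\<^sup>2 + (q3 v)\<^sup>2 = 1"
  then show "v \<in> \<S>"
    by (simp add: unit_imag_def power2_eq_square quat_eq_iff)
qed

lemma unit_imag_square: "v \<in> \<S> \<Longrightarrow> v * v = -1"
  by (simp add: unit_imag_def power2_eq_square)

lemma unit_imag_uminus: "v \<in> \<S> \<Longrightarrow> - v \<in> \<S>"
  by (simp add: unit_imag_iff)

lemma unit_imag_nonempty: "Quat 0 1 0 0 \<in> \<S>"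
  by (simp add: unit_imag_iff)

lemma quat_sel_of_real [simp]:
  "q0 (of_real r) = r" "q1 (of_real r) = 0" "q2 (of_real r) = 0" "q3 (of_real r) = 0"
  by (simp_all add: of_real_def)

lemma slice_pt_sel:
  assumes "v \<in> \<S>"
  shows "q0 (slice_pt w v) = Re w" "q1 (slice_pt w v) = q1 v * Im w"
    "q2 (slice_pt w v) = q2 v * Im w" "q3 (slice_pt w v) = q3 v * Im w"
  using assms by (simp_all add: slice_pt_def unit_imag_iff)

text \<open>
For a fixed imaginary unit $v$ the slice $\{x + vy\}$ is a copy of the complex field.
\<close>

lemma slice_pt_mult:
  assumes "v \<in> \<S>"
  shows "slice_pt (a * b) v = slice_pt a v * slice_pt b v"
  using assms unfolding unit_imag_iff slice_pt_def quat_eq_iff power2_eq_square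
  by simp algebra

lemma slice_pt_diff: "slice_pt (a - b) v = slice_pt a v - slice_pt b v"
  by (simp add: slice_pt_def algebra_simps)

lemma slice_pt_add: "slice_pt (a + b) v = slice_pt a v + slice_pt b v"
  by (simp add: slice_pt_def algebra_simps)

lemma slice_pt_of_real [simp]: "slice_pt (of_real r) v = of_real r"
  by (simp add: slice_pt_def)

lemma slice_pt_power:
  assumes "v \<in> \<S>"
  shows "slice_pt (a ^ n) v = slice_pt a v ^ n"
proof (induction n)
  case 0
  show ?case by (simp add: slice_pt_def)
next
  case (Suc n)
  then show ?case by (simp add: slice_pt_mult[OF assms])
qed

lemma slice_pt_in_sph: "w \<in> W \<Longrightarrow> v \<in> \<S> \<Longrightarrow> slice_pt w v \<in> sph W"
  by (auto simp: sph_def)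

text \<open>
A quaternion determines its point in the plane up to conjugation, which replaces $v$ by $-v$, and
the unit $v$ is arbitrary at real points.
\<close>

lemma slice_pt_eqD:
  assumes eq: "slice_pt w v = slice_pt w' v'" and v: "v \<in> \<S>" "v' \<in> \<S>"
  shows "w' = w \<and> (Im w = 0 \<or> v' = v) \<or> w' = cnj w \<and> v' = - v"
proof -
  have re: "Re w = Re w'"
    using eq slice_pt_sel(1)[OF v(1), of w] slice_pt_sel(1)[OF v(2), of w'] by simp
  have im: "q1 v * Im w = q1 v' * Im w'" "q2 v * Im w = q2 v' * Im w'"
    "q3 v * Im w = q3 v' * Im w'"
    using eq slice_pt_sel[OF v(1), of w] slice_pt_sel[OF v(2), of w'] by simp_all
  have n: "(q1 v)\<^sup>2 + (q2 v)\<^sup>2 + (q3 v)\<^sup>2 = 1" "(q1 v')\<^sup>2 + (q2 v')\<^sup>2 + (q3 v')\<^sup>2 = 1"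
    "q0 v = 0" "q0 v' = 0"
    using v by (auto simp: unit_imag_iff)
  have "(Im w)\<^sup>2 = ((q1 v)\<^sup>2 + (q2 v)\<^sup>2 + (q3 v)\<^sup>2) * (Im w)\<^sup>2"
    using n by simp
  also have "\<dots> = (q1 v * Im w)\<^sup>2 + (q2 v * Im w)\<^sup>2 + (q3 v * Im w)\<^sup>2"
    by (simp add: algebra_simps power_mult_distrib)
  also have "\<dots> = ((q1 v')\<^sup>2 + (q2 v')\<^sup>2 + (q3 v')\<^sup>2) * (Im w')\<^sup>2"
    unfolding im by (simp add: algebra_simps power_mult_distrib)
  also have "\<dots> = (Im w')\<^sup>2"
    using n by simp
  finally have "Im w' = Im w \<or> Im w' = - Im w"
    by (metis power2_eq_iff)
  then consider "Im w = 0" "Im w' = 0" | "Im w \<noteq> 0" "Im w' = Im w" | "Im w \<noteq> 0" "Im w' = - Im w"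
    by fastforce
  then show ?thesis
  proof cases
    case 1
    with re show ?thesis by (simp add: complex_eq_iff)
  next
    case 2
    with re im n show ?thesis by (simp add: complex_eq_iff quat_eq_iff)
  next
    case 3
    have "(q1 v + q1 v') * Im w = 0" "(q2 v + q2 v') * Im w = 0" "(q3 v + q3 v') * Im w = 0"
      using im 3 by (simp_all add: algebra_simps)
    with 3 have "q1 v' = - q1 v" "q2 v' = - q2 v" "q3 v' = - q3 v"
      by (simp_all add: eq_neg_iff_add_eq_0 add.commute)
    with 3 re n show ?thesis by (simp add: complex_eq_iff quat_eq_iff)
  qed
qed

text \<open>
Comparing the values at $v$ and at $-v$ separates the two parts.
\<close>

lemma slice_values_unique:
  assumes "\<And>v. v \<in> \<S> \<Longrightarrow> a + v * b = a' + v * b'"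
  shows "a = a' \<and> b = b'"
proof -
  let ?i = "Quat 0 1 0 0"
  have "a + ?i * b = a' + ?i * b'" "a + (- ?i) * b = a' + (- ?i) * b'"
    using assms unit_imag_nonempty unit_imag_uminus by blast+
  then show ?thesis
    by (auto simp: quat_eq_iff)
qed

section \<open>Complexified quaternions\<close>

abbreviation cquat :: "quat \<Rightarrow> quat \<Rightarrow> complex ^ 4" where
  "cquat a b \<equiv> assoc_map (\<lambda>_. a) (\<lambda>_. b) 0"

lemma assoc_map_eq_cquat: "assoc_map \<alpha> \<beta> z = cquat (\<alpha> z) (\<beta> z)"
  by (simp add: assoc_map_def)

definition re_part :: "complex ^ 4 \<Rightarrow> quat" where
  "re_part Z = Quat (Re (Z $ 1)) (Re (Z $ 2)) (Re (Z $ 3)) (Re (Z $ 4))"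

definition im_part :: "complex ^ 4 \<Rightarrow> quat" where
  "im_part Z = Quat (Im (Z $ 1)) (Im (Z $ 2)) (Im (Z $ 3)) (Im (Z $ 4))"

lemma vector_4:
  "(vector [a, b, c, d] :: 'a::zero ^ 4) $ 1 = a"
  "(vector [a, b, c, d] :: 'a::zero ^ 4) $ 2 = b"
  "(vector [a, b, c, d] :: 'a::zero ^ 4) $ 3 = c"
  "(vector [a, b, c, d] :: 'a::zero ^ 4) $ 4 = d"
  unfolding vector_def by simp_all

lemma assoc_map_nth:
  "assoc_map \<alpha> \<beta> z $ 1 = Complex (q0 (\<alpha> z)) (q0 (\<beta> z))"
  "assoc_map \<alpha> \<beta> z $ 2 = Complex (q1 (\<alpha> z)) (q1 (\<beta> z))"
  "assoc_map \<alpha> \<beta> z $ 3 = Complex (q2 (\<alpha> z)) (q2 (\<beta> z))"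
  "assoc_map \<alpha> \<beta> z $ 4 = Complex (q3 (\<alpha> z)) (q3 (\<beta> z))"
  by (simp_all add: assoc_map_def vector_4)

lemma parts_assoc_map [simp]:
  "re_part (assoc_map \<alpha> \<beta> z) = \<alpha> z" "im_part (assoc_map \<alpha> \<beta> z) = \<beta> z"
  by (simp_all add: re_part_def im_part_def assoc_map_nth)

lemma assoc_map_parts [simp]: "assoc_map (\<lambda>w. re_part (F w)) (\<lambda>w. im_part (F w)) z = F z"
  by (simp add: vec_eq_iff forall_4 assoc_map_nth re_part_def im_part_def)

text \<open>
The element $a + \iota b$ evaluated at the imaginary unit $v$ in place of $\iota$.
\<close>

definition slice_val :: "complex ^ 4 \<Rightarrow> quat \<Rightarrow> quat" where
  "slice_val Z v = re_part Z + v * im_part Z"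

lemma slice_val_assoc_map: "slice_val (assoc_map \<alpha> \<beta> z) v = \<alpha> z + v * \<beta> z"
  by (simp add: slice_val_def)

lemma slice_val_inject:
  assumes "\<And>v. v \<in> \<S> \<Longrightarrow> slice_val Z v = slice_val Z' v"
  shows "Z = Z'"
proof -
  have "re_part Z = re_part Z' \<and> im_part Z = im_part Z'"
    using assms by (intro slice_values_unique) (auto simp: slice_val_def)
  then show ?thesis
    by (simp add: vec_eq_iff forall_4 re_part_def im_part_def complex_eq_iff)
qed

text \<open>
Complex scalars act on the value at $v$ through the copy of the complex field in the slice of $v$,
because they commute with the quaternionic units.
\<close>

lemma slice_val_scale:
  assumes "v \<in> \<S>"
  shows "slice_val (c *s Z) v = slice_pt c v * slice_val Z v"
  using assms
  unfolding slice_val_def slice_pt_def re_part_def im_part_def quat_eq_iff unit_imag_iff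
    power2_eq_square
  by simp algebra

lemma Phi_eq: "\<Phi> Z = (Z $ 1)\<^sup>2 + (Z $ 2)\<^sup>2 + (Z $ 3)\<^sup>2 + (Z $ 4)\<^sup>2"
  by (simp add: Phi_def sum_4)

lemma Phi_scale: "\<Phi> (c *s Z) = c\<^sup>2 * \<Phi> Z"
  by (simp add: Phi_eq power_mult_distrib algebra_simps)

text \<open>
The product of $\mathbb{H} \otimes \mathbb{C}$ in the basis $1, i, j, k$.
\<close>

definition cquat_mult :: "complex ^ 4 \<Rightarrow> complex ^ 4 \<Rightarrow> complex ^ 4"  (infixl \<open>\<diamondop>\<close> 70) where
  "Z \<diamondop> Y = vector
     [Z$1 * Y$1 - Z$2 * Y$2 - Z$3 * Y$3 - Z$4 * Y$4,
      Z$1 * Y$2 + Z$2 * Y$1 + Z$3 * Y$4 - Z$4 * Y$3,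
      Z$1 * Y$3 - Z$2 * Y$4 + Z$3 * Y$1 + Z$4 * Y$2,
      Z$1 * Y$4 + Z$2 * Y$3 - Z$3 * Y$2 + Z$4 * Y$1]"

lemma cquat_mult_nth:
  "(Z \<diamondop> Y) $ 1 = Z$1 * Y$1 - Z$2 * Y$2 - Z$3 * Y$3 - Z$4 * Y$4"
  "(Z \<diamondop> Y) $ 2 = Z$1 * Y$2 + Z$2 * Y$1 + Z$3 * Y$4 - Z$4 * Y$3"
  "(Z \<diamondop> Y) $ 3 = Z$1 * Y$3 - Z$2 * Y$4 + Z$3 * Y$1 + Z$4 * Y$2"
  "(Z \<diamondop> Y) $ 4 = Z$1 * Y$4 + Z$2 * Y$3 - Z$3 * Y$2 + Z$4 * Y$1"
  by (simp_all add: cquat_mult_def vector_4)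

text \<open>
Euler's four-square identity, over the complex numbers.
\<close>

lemma Phi_mult: "\<Phi> (Z \<diamondop> Y) = \<Phi> Z * \<Phi> Y"
  unfolding Phi_eq cquat_mult_nth by algebra

lemma cquat_mult_assoc_map:
  "assoc_map \<alpha> \<beta> z \<diamondop> assoc_map \<gamma> \<delta> z
     = cquat (\<alpha> z * \<gamma> z - \<beta> z * \<delta> z) (\<alpha> z * \<delta> z + \<beta> z * \<gamma> z)"
  by (simp add: vec_eq_iff forall_4 cquat_mult_nth assoc_map_nth complex_eq_iff)

text \<open>
  $\Phi(a + \iota b) = |a|^2 - |b|^2 + 2\iota\langle a, b\rangle$, so its vanishing says that $a$
  and $b$ are orthogonal of equal length, which is exactly when $v = -ab^{-1}$ lies in
  $\mathbb{S}$ (or both are zero).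
\<close>

lemma Phi_eq_0_iff: "\<Phi> Z = 0 \<longleftrightarrow> (\<exists>v\<in>\<S>. slice_val Z v = 0)"
proof -
  define a b where "a = re_part Z" and "b = im_part Z"
  have Z: "\<Phi> Z = Complex (inner a a - inner b b) (2 * inner a b)"
    by (simp add: Phi_eq a_def b_def re_part_def im_part_def inner_quat_def complex_eq_iff
        power2_eq_square algebra_simps)
  show ?thesis
  proof
    assume "\<Phi> Z = 0"
    with Z have eqs: "inner a a = inner b b" "inner a b = 0"
      by (auto simp: complex_eq_iff)
    show "\<exists>v\<in>\<S>. slice_val Z v = 0"
    proof (cases "b = 0")
      case True
      with eqs have "a = 0" by simp
      with True show ?thesis
        using unit_imag_nonempty by (auto simp: slice_val_def a_def b_def)
    next
      case False
      define v where "v = - (a * inverse b)"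
      have "q0 v = - (inverse (inner b b) * inner a b)"
        by (simp add: v_def inverse_quat_def inner_quat_def algebra_simps)
      then have q0: "q0 v = 0"
        using eqs by simp
      have "norm a = norm b"
        using eqs by (simp add: norm_quat_def)
      then have "norm v = 1"
        using False by (simp add: v_def norm_mult norm_inverse)
      then have "inner v v = 1"
        by (simp add: norm_quat_def)
      with q0 have "v \<in> \<S>"
        by (simp add: unit_imag_iff inner_quat_def power2_eq_square)
      moreover have "v * b = - a"
        using False by (simp add: v_def mult.assoc)
      ultimately show ?thesis
        by (intro bexI[of _ v]) (simp_all add: slice_val_def a_def b_def)
    qed
  next
    assume "\<exists>v\<in>\<S>. slice_val Z v = 0"
    then obtain v where v: "v \<in> \<S>" and "a + v * b = 0"
      by (auto simp: slice_val_def a_def b_def)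
    then have a: "a = - (v * b)"
      by (simp add: eq_neg_iff_add_eq_0)
    have "norm v = 1"
      using v by (simp add: unit_imag_iff norm_quat_def inner_quat_def power2_eq_square)
    then have "inner a a = inner b b"
      by (simp add: a norm_mult dot_square_norm)
    moreover have "inner a b = 0"
      using v unfolding a unit_imag_iff inner_quat_def power2_eq_square
      by (simp add: algebra_simps)
    ultimately show "\<Phi> Z = 0"
      using Z by (simp add: complex_eq_iff)
  qed
qed

section \<open>Stems of slice-regular functions\<close>

text \<open>
The condition under conjugation says that the real part is even and the imaginary part odd in $y$.
\<close>

definition stem_on :: "complex set \<Rightarrow> (complex \<Rightarrow> complex ^ 4) \<Rightarrow> bool" where
  "stem_on W F \<longleftrightarrow> open W \<and> conj_invariant W \<and>
     (\<forall>l. (\<lambda>z. F z $ l) holomorphic_on W) \<and> (\<forall>z\<in>W. \<forall>l. F (cnj z) $ l = cnj (F z $ l))"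

lemma stem_on_open: "stem_on W F \<Longrightarrow> open W"
  and stem_on_conj_invariant: "stem_on W F \<Longrightarrow> conj_invariant W"
  and stem_on_cnj: "stem_on W F \<Longrightarrow> z \<in> W \<Longrightarrow> F (cnj z) $ l = cnj (F z $ l)"
  and stem_on_holomorphic: "stem_on W F \<Longrightarrow> (\<lambda>z. F z $ l) holomorphic_on W"
  by (simp_all add: stem_on_def)

lemma conj_invariant_image: "conj_invariant W \<Longrightarrow> cnj ` W = W"
  by (force simp: conj_invariant_def image_iff intro: bexI[of _ "cnj _"])

text \<open>
The partial derivatives are defined along lines; for a differentiable map they are the values of the
total derivative at $1$ and at $\iota$.
\<close>

lemma partial_x_eq:
  assumes "(h has_derivative A) (at z)"
  shows "partial_x h z = A 1"
proof -
  have "((\<lambda>t. Complex t (Im z)) has_derivative of_real) (at (Re z))"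
    unfolding Complex_eq by (auto intro!: derivative_eq_intros)
  moreover have "(h has_derivative A) (at (Complex (Re z) (Im z)))"
    using assms by simp
  ultimately have "((\<lambda>t. h (Complex t (Im z))) has_derivative (\<lambda>s. A (of_real s))) (at (Re z))"
    by (rule has_derivative_compose)
  moreover have "A (of_real s) = s *\<^sub>R A 1" for s
    using linear_scale[OF has_derivative_linear[OF assms], of s 1] by (simp add: of_real_def)
  ultimately show ?thesis
    unfolding partial_x_def by (intro vector_derivative_at) (simp add: has_vector_derivative_def)
qed

lemma partial_y_eq:
  assumes "(h has_derivative A) (at z)"
  shows "partial_y h z = A \<i>"
proof -
  have "((\<lambda>t. Complex (Re z) t) has_derivative (\<lambda>s. \<i> * of_real s)) (at (Im z))"
    unfolding Complex_eq by (auto intro!: derivative_eq_intros)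
  moreover have "(h has_derivative A) (at (Complex (Re z) (Im z)))"
    using assms by simp
  ultimately have "((\<lambda>t. h (Complex (Re z) t)) has_derivative (\<lambda>s. A (\<i> * of_real s))) (at (Im z))"
    by (rule has_derivative_compose)
  moreover have "A (\<i> * of_real s) = s *\<^sub>R A \<i>" for s
    using linear_scale[OF has_derivative_linear[OF assms], of s \<i>]
    by (simp add: scaleR_conv_of_real mult.commute)
  ultimately show ?thesis
    unfolding partial_y_def by (intro vector_derivative_at) (simp add: has_vector_derivative_def)
qed

lemma bounded_linear_quat_sel:
  "bounded_linear q0" "bounded_linear q1" "bounded_linear q2" "bounded_linear q3"
proof -
  have "q0 = (\<lambda>a. inner a (Quat 1 0 0 0))" "q1 = (\<lambda>a. inner a (Quat 0 1 0 0))"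
    "q2 = (\<lambda>a. inner a (Quat 0 0 1 0))" "q3 = (\<lambda>a. inner a (Quat 0 0 0 1))"
    by (simp_all add: inner_quat_def fun_eq_iff)
  then show "bounded_linear q0" "bounded_linear q1" "bounded_linear q2" "bounded_linear q3"
    using bounded_linear_inner_left by metis+
qed

text \<open>
A real functional applied to both parts of the pair preserves the Cauchy-Riemann equations, so each
coordinate of the pair is holomorphic.
\<close>

lemma holomorphic_component:
  assumes "open W" and q: "bounded_linear q"
    and diff: "\<And>z. z \<in> W \<Longrightarrow> \<alpha> differentiable (at z)" "\<And>z. z \<in> W \<Longrightarrow> \<beta> differentiable (at z)"
    and CR: "\<And>z. z \<in> W \<Longrightarrow> partial_x \<alpha> z = partial_y \<beta> z" "\<And>z. z \<in> W \<Longrightarrow> partial_y \<alpha> z = - partial_x \<beta> z"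
  shows "(\<lambda>z. Complex (q (\<alpha> z)) (q (\<beta> z))) holomorphic_on W"
proof -
  have "\<exists>d. ((\<lambda>z. Complex (q (\<alpha> z)) (q (\<beta> z))) has_field_derivative d) (at z)" if z: "z \<in> W" for z
  proof -
    obtain A B where AB: "(\<alpha> has_derivative A) (at z)" "(\<beta> has_derivative B) (at z)"
      using diff[OF z] by (auto simp: differentiable_def)
    have AB1: "A 1 = B \<i>" "A \<i> = - B 1"
      using CR[OF z] AB by (simp_all add: partial_x_eq partial_y_eq)
    have lin: "linear A" "linear B" "linear q"
      using AB q by (auto intro: has_derivative_linear bounded_linear.linear)
    have h: "h = Re h *\<^sub>R 1 + Im h *\<^sub>R \<i>" for h
      by (simp add: complex_eq_iff)
    have expand: "L h = Re h *\<^sub>R L 1 + Im h *\<^sub>R L \<i>" if "linear L" for L :: "complex \<Rightarrow> quat" and h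
      by (subst h) (simp add: linear_add[OF that] linear_scale[OF that] del: scaleR_conv_of_real)
    have "((\<lambda>z. of_real (q (\<alpha> z)) + \<i> * of_real (q (\<beta> z))) has_derivative
            (\<lambda>h. of_real (q (A h)) + \<i> * of_real (q (B h)))) (at z)"
      by (intro derivative_intros bounded_linear.has_derivative[OF q] AB)
    moreover have "(\<lambda>h. of_real (q (A h)) + \<i> * of_real (q (B h)))
        = (*) (Complex (q (A 1)) (q (B 1)))"
    proof
      fix h
      show "of_real (q (A h)) + \<i> * of_real (q (B h)) = Complex (q (A 1)) (q (B 1)) * h"
        unfolding expand[OF lin(1), of h] expand[OF lin(2), of h] AB1
        by (simp add: linear_add[OF lin(3)] linear_scale[OF lin(3)] linear_neg[OF lin(3)]
            linear_diff[OF lin(3)] complex_eq_iff)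
    qed
    ultimately show ?thesis
      unfolding Complex_eq has_field_derivative_def by auto
  qed
  then show ?thesis
    using \<open>open W\<close> by (auto simp: holomorphic_on_open)
qed

lemma slice_regular_with_imp_stem:
  assumes "slice_regular_with W f \<alpha> \<beta>"
  shows "stem_on W (assoc_map \<alpha> \<beta>)"
    and "\<And>z v. z \<in> W \<Longrightarrow> v \<in> \<S> \<Longrightarrow> f (slice_pt z v) = slice_val (assoc_map \<alpha> \<beta> z) v"
proof -
  have W: "open W" "conj_invariant W"
    and diff: "\<And>z. z \<in> W \<Longrightarrow> \<alpha> differentiable (at z)" "\<And>z. z \<in> W \<Longrightarrow> \<beta> differentiable (at z)"
    and CR: "\<And>z. z \<in> W \<Longrightarrow> partial_x \<alpha> z = partial_y \<beta> z" "\<And>z. z \<in> W \<Longrightarrow> partial_y \<alpha> z = - partial_x \<beta> z"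
    and cnj: "\<And>z. z \<in> W \<Longrightarrow> \<alpha> (cnj z) = \<alpha> z" "\<And>z. z \<in> W \<Longrightarrow> \<beta> (cnj z) = - \<beta> z"
    using assms by (auto simp: slice_regular_with_def)
  note hol = holomorphic_component[OF W(1) _ diff CR]
  have "\<forall>l. (\<lambda>z. assoc_map \<alpha> \<beta> z $ l) holomorphic_on W"
    unfolding forall_4 assoc_map_nth by (intro conjI hol bounded_linear_quat_sel)
  moreover have "\<forall>z\<in>W. \<forall>l. assoc_map \<alpha> \<beta> (cnj z) $ l = cnj (assoc_map \<alpha> \<beta> z $ l)"
    unfolding forall_4 assoc_map_nth by (simp add: cnj complex_eq_iff)
  ultimately show "stem_on W (assoc_map \<alpha> \<beta>)"
    using W by (simp add: stem_on_def)
  show "f (slice_pt z v) = slice_val (assoc_map \<alpha> \<beta> z) v" if "z \<in> W" "v \<in> \<S>" for z v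
    using assms that by (simp add: slice_regular_with_def slice_val_assoc_map)
qed

lemma re_part_expand:
  "re_part Z = Re (Z $ 1) *\<^sub>R Quat 1 0 0 0 + Re (Z $ 2) *\<^sub>R Quat 0 1 0 0
    + Re (Z $ 3) *\<^sub>R Quat 0 0 1 0 + Re (Z $ 4) *\<^sub>R Quat 0 0 0 1"
  by (simp add: re_part_def quat_eq_iff)

lemma im_part_expand:
  "im_part Z = Im (Z $ 1) *\<^sub>R Quat 1 0 0 0 + Im (Z $ 2) *\<^sub>R Quat 0 1 0 0
    + Im (Z $ 3) *\<^sub>R Quat 0 0 1 0 + Im (Z $ 4) *\<^sub>R Quat 0 0 0 1"
  by (simp add: im_part_def quat_eq_iff)

lemma stem_imp_slice_regular_with:
  assumes F: "stem_on W F" and f: "\<And>z v. z \<in> W \<Longrightarrow> v \<in> \<S> \<Longrightarrow> f (slice_pt z v) = slice_val (F z) v"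
  shows "slice_regular_with W f (\<lambda>z. re_part (F z)) (\<lambda>z. im_part (F z))"
proof -
  let ?\<alpha> = "\<lambda>z. re_part (F z)" and ?\<beta> = "\<lambda>z. im_part (F z)"
  have derivs: "?\<alpha> differentiable (at z) \<and> ?\<beta> differentiable (at z) \<and>
      partial_x ?\<alpha> z = partial_y ?\<beta> z \<and> partial_y ?\<alpha> z = - partial_x ?\<beta> z" if z: "z \<in> W" for z
  proof -
    have "\<forall>l. \<exists>d. ((\<lambda>z. F z $ l) has_field_derivative d) (at z)"
      using stem_on_holomorphic[OF F] stem_on_open[OF F] z by (auto simp: holomorphic_on_open)
    then obtain d where "\<And>l. ((\<lambda>z. F z $ l) has_field_derivative d l) (at z)"
      by metis
    then have d: "((\<lambda>z. F z $ l) has_derivative (*) (d l)) (at z)" for l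
      by (simp add: has_field_derivative_def)
    define D where "D h = (\<chi> l. d l * h)" for h
    have re: "((\<lambda>z. Re (F z $ l)) has_derivative (\<lambda>h. Re (D h $ l))) (at z)" for l
      unfolding D_def vec_lambda_beta by (intro bounded_linear.has_derivative[OF bounded_linear_Re] d)
    have im: "((\<lambda>z. Im (F z $ l)) has_derivative (\<lambda>h. Im (D h $ l))) (at z)" for l
      unfolding D_def vec_lambda_beta by (intro bounded_linear.has_derivative[OF bounded_linear_Im] d)
    have "(?\<alpha> has_derivative (\<lambda>h. re_part (D h))) (at z)"
      unfolding re_part_expand by (intro has_derivative_add has_derivative_scaleR_left re)
    moreover have "(?\<beta> has_derivative (\<lambda>h. im_part (D h))) (at z)"
      unfolding im_part_expand by (intro has_derivative_add has_derivative_scaleR_left im)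
    ultimately show ?thesis
      by (auto simp: partial_x_eq partial_y_eq differentiable_def)
        (simp_all add: quat_eq_iff re_part_def im_part_def D_def)
  qed
  have "?\<alpha> (cnj z) = ?\<alpha> z" "?\<beta> (cnj z) = - ?\<beta> z" if "z \<in> W" for z
    by (simp_all add: re_part_def im_part_def stem_on_cnj[OF F that] quat_eq_iff)
  then show ?thesis
    unfolding slice_regular_with_def
    using derivs stem_on_open[OF F] stem_on_conj_invariant[OF F] f
    by (auto simp: slice_val_def)
qed

text \<open>
The two representations of a non-real quaternion, by $(z, v)$ and by $(\bar z, -v)$, give the same
value because of the symmetry of the stem; at a real point the imaginary part vanishes and the
choice of $v$ does not matter.
\<close>

lemma stem_induces_function:
  assumes F: "stem_on W F"
  obtains f where "\<And>z v. z \<in> W \<Longrightarrow> v \<in> \<S> \<Longrightarrow> f (slice_pt z v) = slice_val (F z) v"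
proof -
  define P where "P q r \<longleftrightarrow> (\<exists>z\<in>W. \<exists>v\<in>\<S>. q = slice_pt z v \<and> r = slice_val (F z) v)" for q r
  have "(SOME r. P (slice_pt z v) r) = slice_val (F z) v" if zv: "z \<in> W" "v \<in> \<S>" for z v
  proof -
    have "P (slice_pt z v) (SOME r. P (slice_pt z v) r)"
      by (rule someI[of _ "slice_val (F z) v"]) (use zv in \<open>auto simp: P_def\<close>)
    then obtain w u where w: "w \<in> W" "u \<in> \<S>" "slice_pt z v = slice_pt w u"
      and some: "(SOME r. P (slice_pt z v) r) = slice_val (F w) u"
      by (auto simp: P_def)
    have "slice_val (F w) u = slice_val (F z) v"
      using slice_pt_eqD[OF w(3) zv(2) w(2)]
    proof
      assume "w = z \<and> (Im z = 0 \<or> u = v)"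
      moreover have "im_part (F z) = 0" if "Im z = 0"
      proof -
        have "cnj z = z" using that by (simp add: complex_eq_iff)
        then have "\<And>l. Im (F z $ l) = 0"
          using stem_on_cnj[OF F zv(1)] by (metis cnj.simps(2) equal_neg_zero)
        then show ?thesis by (simp add: im_part_def quat_eq_iff)
      qed
      ultimately show ?thesis by (auto simp: slice_val_def)
    next
      assume "w = cnj z \<and> u = - v"
      then show ?thesis
        by (simp add: slice_val_def quat_eq_iff re_part_def im_part_def stem_on_cnj[OF F zv(1)])
    qed
    with some show ?thesis by simp
  qed
  then show ?thesis by (rule that[of "\<lambda>q. SOME r. P q r"])
qed

lemma Phi_stem_holomorphic: "stem_on W F \<Longrightarrow> (\<lambda>z. \<Phi> (F z)) holomorphic_on W"
  unfolding Phi_eq by (intro holomorphic_intros stem_on_holomorphic)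

lemma Phi_stem_cnj: "stem_on W F \<Longrightarrow> z \<in> W \<Longrightarrow> \<Phi> (F (cnj z)) = cnj (\<Phi> (F z))"
  by (simp add: Phi_eq stem_on_cnj)

section \<open>Division of stems\<close>

lemma holomorphic_divide_root:
  assumes "f holomorphic_on W" "open W" "f z = 0"
  obtains g where "g holomorphic_on W" "\<And>w. w \<in> W \<Longrightarrow> f w = (w - z) * g w"
proof -
  define g where "g w = (if w = z then deriv f z else (f w - f z) / (w - z))" for w
  have "g holomorphic_on W"
    unfolding g_def using pole_lemma_open[OF assms(1,2)] .
  moreover have "f w = (w - z) * g w" for w
    using assms(3) by (simp add: g_def)
  ultimately show ?thesis using that by blast
qed

text \<open>
The componentwise quotients need not be symmetric under conjugation at the zeros of $c$.  If $h$ is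
a quotient, so is $w \mapsto \overline{h(\bar w)}$, since $c$ is symmetric; the average of the two
is a quotient with the required symmetry.
\<close>

lemma stem_divide:
  assumes F: "stem_on W F" and c: "\<And>z. z \<in> W \<Longrightarrow> c (cnj z) = cnj (c z)"
    and div: "\<And>l. \<exists>h. h holomorphic_on W \<and> (\<forall>w\<in>W. F w $ l = c w * h w)"
  obtains G where "stem_on W G" "\<And>w. w \<in> W \<Longrightarrow> F w = c w *s G w"
proof -
  obtain h where "\<forall>l. h l holomorphic_on W \<and> (\<forall>w\<in>W. F w $ l = c w * h l w)"
    using choice[of "\<lambda>l h. h holomorphic_on W \<and> (\<forall>w\<in>W. F w $ l = c w * h w)"] div by blast
  then have h: "\<And>l. h l holomorphic_on W" "\<And>l w. w \<in> W \<Longrightarrow> F w $ l = c w * h l w"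
    by blast+
  have W: "open W" "cnj ` W = W" "\<And>z. z \<in> W \<Longrightarrow> cnj z \<in> W"
    using F by (auto simp: stem_on_def conj_invariant_image conj_invariant_def)
  define G where "G w = (\<chi> l. (h l w + cnj (h l (cnj w))) / 2)" for w
  have "(\<lambda>w. (h l w + cnj (h l (cnj w))) / 2) holomorphic_on W" for l
    using holomorphic_on_compose_cnj_cnj[of "h l" W] h(1)[of l] W
    by (intro holomorphic_intros) (auto simp: o_def)
  then have "stem_on W G"
    using F by (auto simp: stem_on_def G_def add.commute)
  moreover have "F w = c w *s G w" if "w \<in> W" for w
  proof -
    have "F w $ l = G w $ l * c w" for l
    proof -
      have "cnj (F w $ l) = cnj (c w) * h l (cnj w)"
        using h(2)[OF W(3)[OF that], of l] by (simp only: stem_on_cnj[OF F that] c[OF that])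
      from arg_cong[OF this, of cnj] have "F w $ l = c w * cnj (h l (cnj w))"
        by simp
      then have "F w $ l + F w $ l = c w * h l w + c w * cnj (h l (cnj w))"
        using h(2)[OF that, of l] by simp
      then show ?thesis
        by (simp add: G_def field_simps)
    qed
    then show ?thesis
      by (simp add: vec_eq_iff mult.commute)
  qed
  ultimately show ?thesis by (rule that)
qed

text \<open>
The complex form of $(q - x)^2 + y^2$, the polynomial vanishing on the sphere of $z$.
\<close>

definition sphere_poly :: "complex \<Rightarrow> complex \<Rightarrow> complex" where
  "sphere_poly z w = (w - z) * (w - cnj z)"

lemma sphere_poly_eq: "sphere_poly z w = (w - of_real (Re z))\<^sup>2 + of_real ((Im z)\<^sup>2)"
  by (simp add: sphere_poly_def complex_eq_iff power2_eq_square algebra_simps)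

lemma sphere_poly_cnj: "sphere_poly z (cnj w) = cnj (sphere_poly z w)"
  by (simp add: sphere_poly_def mult.commute)

lemma sphere_poly_root: "sphere_poly z z = 0"
  by (simp add: sphere_poly_def)

lemma sphere_poly_holomorphic: "sphere_poly z holomorphic_on W"
  unfolding sphere_poly_def [abs_def] by (intro holomorphic_intros)

lemma stem_divide_real:
  assumes F: "stem_on W F" and x: "F (of_real x) = 0"
  obtains G where "stem_on W G" "\<And>w. w \<in> W \<Longrightarrow> F w = (w - of_real x) *s G w"
proof -
  have "\<exists>h. h holomorphic_on W \<and> (\<forall>w\<in>W. F w $ l = (w - of_real x) * h w)" for l
  proof -
    obtain h where "h holomorphic_on W" "\<And>w. w \<in> W \<Longrightarrow> F w $ l = (w - of_real x) * h w"
      using holomorphic_divide_root[OF stem_on_holomorphic[OF F, of l] stem_on_open[OF F], of "of_real x"] x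
      by auto
    then show ?thesis by auto
  qed
  moreover have "cnj w - of_real x = cnj (w - of_real x)" for w
    by simp
  ultimately show ?thesis
    using stem_divide[OF F, of "\<lambda>w. w - of_real x"] that by metis
qed

text \<open>
By symmetry a zero at $z$ comes with a zero at $\bar z$, and both can be divided out because the
two points are distinct.
\<close>

lemma stem_divide_sphere:
  assumes F: "stem_on W F" and z: "z \<in> W" "F z = 0" "Im z \<noteq> 0"
  obtains G where "stem_on W G" "\<And>w. w \<in> W \<Longrightarrow> F w = sphere_poly z w *s G w"
proof -
  have "\<exists>h. h holomorphic_on W \<and> (\<forall>w\<in>W. F w $ l = sphere_poly z w * h w)" for l
  proof -
    note W = stem_on_open[OF F]
    obtain g where g: "g holomorphic_on W" "\<And>w. w \<in> W \<Longrightarrow> F w $ l = (w - z) * g w"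
      using holomorphic_divide_root[OF stem_on_holomorphic[OF F, of l] W, of z] z(2) by auto
    have cz: "cnj z \<in> W" "cnj z \<noteq> z"
      using F z by (auto simp: stem_on_def conj_invariant_def complex_eq_iff)
    then have "g (cnj z) = 0"
      using g(2)[of "cnj z"] stem_on_cnj[OF F z(1), of l] z(2) by simp
    then obtain h where "h holomorphic_on W" "\<And>w. w \<in> W \<Longrightarrow> g w = (w - cnj z) * h w"
      using holomorphic_divide_root[OF g(1) W] by blast
    with g(2) show ?thesis
      by (intro exI[of _ h]) (simp add: sphere_poly_def)
  qed
  then show ?thesis
    using stem_divide[OF F, of "sphere_poly z"] sphere_poly_cnj that by metis
qed

definition cquat_cnj :: "complex ^ 4 \<Rightarrow> complex ^ 4" where
  "cquat_cnj Z = vector [Z $ 1, - (Z $ 2), - (Z $ 3), - (Z $ 4)]"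

lemma cquat_mult_cnj: "Z \<diamondop> (cquat_cnj Z \<diamondop> Y) = \<Phi> Z *s Y"
  by (simp add: vec_eq_iff forall_4 cquat_mult_nth cquat_cnj_def vector_4 Phi_eq
      power2_eq_square algebra_simps)

lemma cquat_mult_scale_right: "Z \<diamondop> (c *s Y) = c *s (Z \<diamondop> Y)"
  by (simp add: vec_eq_iff forall_4 cquat_mult_nth algebra_simps)

text \<open>
The stem $w \mapsto w - p$ of the slice-regular function $q \mapsto q - p$.
\<close>

definition linear_stem :: "quat \<Rightarrow> complex \<Rightarrow> complex ^ 4" where
  "linear_stem p = assoc_map (\<lambda>w. of_real (Re w) - p) (\<lambda>w. of_real (Im w))"

lemma linear_stem_nth:
  "linear_stem p w $ 1 = w - of_real (q0 p)" "linear_stem p w $ 2 = - of_real (q1 p)"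
  "linear_stem p w $ 3 = - of_real (q2 p)" "linear_stem p w $ 4 = - of_real (q3 p)"
  by (simp_all add: linear_stem_def assoc_map_nth complex_eq_iff)

lemma linear_stem_on:
  assumes "open W" "conj_invariant W"
  shows "stem_on W (linear_stem p)"
  unfolding stem_on_def forall_4 linear_stem_nth
  using assms by (auto intro!: holomorphic_intros)

lemma slice_val_linear_stem: "slice_val (linear_stem p w) v = slice_pt w v - p"
  by (simp add: linear_stem_def slice_val_assoc_map slice_pt_def)

lemma slice_regular_with_linear:
  assumes "open W" "conj_invariant W"
  shows "slice_regular_with W (\<lambda>q. q - p) (\<lambda>w. re_part (linear_stem p w)) (\<lambda>w. im_part (linear_stem p w))"
  by (rule stem_imp_slice_regular_with[OF linear_stem_on[OF assms]])
    (simp add: slice_val_linear_stem)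

text \<open>
With $p = x + vy$ this is $(w - x)^2 + |vy|^2$, whichever unit $v$ is taken.
\<close>

lemma Phi_linear_stem:
  assumes "p \<in> sph {z}"
  shows "\<Phi> (linear_stem p w) = sphere_poly z w"
proof -
  obtain v where v: "v \<in> \<S>" and p: "p = slice_pt z v"
    using assms by (auto simp: sph_def)
  have "(q1 p)\<^sup>2 + (q2 p)\<^sup>2 + (q3 p)\<^sup>2 = ((q1 v)\<^sup>2 + (q2 v)\<^sup>2 + (q3 v)\<^sup>2) * (Im z)\<^sup>2"
    by (simp add: p slice_pt_sel[OF v] power_mult_distrib algebra_simps)
  also have "\<dots> = (Im z)\<^sup>2"
    using v by (simp add: unit_imag_iff)
  finally have "of_real ((Im z)\<^sup>2) = (of_real ((q1 p)\<^sup>2 + (q2 p)\<^sup>2 + (q3 p)\<^sup>2) :: complex)"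
    by simp
  then show ?thesis
    unfolding sphere_poly_eq Phi_eq linear_stem_nth
    by (simp add: p slice_pt_sel[OF v])
qed

lemma stem_on_mult:
  assumes "stem_on W F" "stem_on W G"
  shows "stem_on W (\<lambda>w. F w \<diamondop> G w)"
  using assms unfolding stem_on_def forall_4 cquat_mult_nth
  by (auto intro!: holomorphic_intros)

lemma stem_on_cquat_cnj:
  assumes "stem_on W F"
  shows "stem_on W (\<lambda>w. cquat_cnj (F w))"
  using assms unfolding stem_on_def forall_4 cquat_cnj_def vector_4
  by (auto intro!: holomorphic_intros)

text \<open>
Off the two roots of the polynomial one may divide; the set where the stems differ is open and
contained in a set of two points, hence empty.
\<close>

lemma stem_cancel_sphere_poly:
  assumes F: "stem_on W F" and G: "stem_on W G"
    and eq: "\<And>w. w \<in> W \<Longrightarrow> sphere_poly z w *s F w = sphere_poly z w *s G w" and "w \<in> W"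
  shows "F w = G w"
proof -
  have "F w $ l = G w $ l" for l
  proof -
    let ?N = "{u \<in> W. F u $ l - G u $ l \<noteq> 0}"
    have "continuous_on W (\<lambda>u. F u $ l - G u $ l)"
      by (intro holomorphic_on_imp_continuous_on holomorphic_on_diff stem_on_holomorphic F G)
    then have "open ?N"
      using continuous_open_preimage[OF _ stem_on_open[OF F], of "\<lambda>u. F u $ l - G u $ l" "- {0}"]
      by (simp add: vimage_def Int_def open_Compl)
    moreover have "?N \<subseteq> {z, cnj z}"
    proof
      fix u assume u: "u \<in> ?N"
      then have "sphere_poly z u * F u $ l = sphere_poly z u * G u $ l"
        using arg_cong[OF eq[of u], of "\<lambda>Z. Z $ l"] by simp
      with u have "sphere_poly z u = 0"
        by auto
      then show "u \<in> {z, cnj z}"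
        by (auto simp: sphere_poly_def)
    qed
    then have "finite ?N"
      by (rule finite_subset) simp
    ultimately have "?N = {}"
      using finite_imp_not_open by blast
    with \<open>w \<in> W\<close> show ?thesis by auto
  qed
  then show ?thesis by (simp add: vec_eq_iff)
qed

text \<open>
Multiply $F$ on the left by the conjugate stem $w - \bar p$.  At $z$ this factor is
$y(\iota + v)$, and $(\iota + v)(a + \iota b) = (\iota + v)(a + vb)$, so the product vanishes at
$z$ when $F$ has the value $0$ at $p$.  It is therefore divisible by the polynomial of the sphere,
which equals $(w - p)(w - \bar p)$, and the quotient is the left quotient of $F$ by $w - p$.
\<close>

lemma stem_divide_linear:
  assumes F: "stem_on W F" and z: "z \<in> W" "Im z \<noteq> 0" and v: "v \<in> \<S>" and zero: "slice_val (F z) v = 0"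
  obtains G where "stem_on W G" "\<And>w. w \<in> W \<Longrightarrow> F w = linear_stem (slice_pt z v) w \<diamondop> G w"
proof -
  define L where "L = linear_stem (slice_pt z v)"
  define H where "H w = cquat_cnj (L w) \<diamondop> F w" for w
  have L: "stem_on W L"
    unfolding L_def using F by (intro linear_stem_on) (auto simp: stem_on_def)
  then have H: "stem_on W H"
    unfolding H_def by (intro stem_on_mult stem_on_cquat_cnj F)
  have "H z = 0"
  proof -
    define a b where "a = re_part (F z)" and "b = im_part (F z)"
    have Fz: "F z = cquat a b"
      using assoc_map_parts[of F z] by (simp add: a_def b_def assoc_map_eq_cquat)
    have "a + v * b = 0"
      using zero by (simp add: slice_val_def a_def b_def)
    then have a: "a = - (v * b)"
      by (simp add: eq_neg_iff_add_eq_0)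
    have "v * a = b"
      using unit_imag_square[OF v] by (simp add: a mult.assoc[symmetric])
    (* The conjugate stem at z is y times the sum of v and the imaginary unit. *)
    have "cquat_cnj (L z) = cquat (of_real (Im z) * v) (of_real (Im z))"
      using v by (simp add: vec_eq_iff forall_4 cquat_cnj_def vector_4 L_def linear_stem_nth
          slice_pt_sel assoc_map_nth complex_eq_iff unit_imag_iff)
    then have "H z = cquat (of_real (Im z) * v * a - of_real (Im z) * b)
                          (of_real (Im z) * v * b + of_real (Im z) * a)"
      by (simp add: H_def Fz cquat_mult_assoc_map)
    also have "of_real (Im z) * v * a - of_real (Im z) * b = 0"
      using \<open>v * a = b\<close> by (simp add: mult.assoc)
    also have "of_real (Im z) * v * b + of_real (Im z) * a = 0"
      by (simp add: a mult.assoc)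
    finally show ?thesis
      by (simp add: vec_eq_iff forall_4 assoc_map_nth complex_eq_iff)
  qed
  then obtain G where G: "stem_on W G" "\<And>w. w \<in> W \<Longrightarrow> H w = sphere_poly z w *s G w"
    using stem_divide_sphere[OF H z(1) _ z(2)] by blast
  have "F w = L w \<diamondop> G w" if "w \<in> W" for w
  proof (rule stem_cancel_sphere_poly[OF F stem_on_mult[OF L G(1)] _ that])
    fix w assume w: "w \<in> W"
    have "sphere_poly z w = \<Phi> (L w)"
      unfolding L_def using v by (subst Phi_linear_stem[of _ z]) (auto simp: sph_def)
    then have "sphere_poly z w *s F w = L w \<diamondop> H w"
      by (simp add: H_def cquat_mult_cnj)
    also have "\<dots> = sphere_poly z w *s (L w \<diamondop> G w)"
      using G(2)[OF w] by (simp add: cquat_mult_scale_right)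
    finally show "sphere_poly z w *s F w = sphere_poly z w *s (L w \<diamondop> G w)" .
  qed
  then show ?thesis
    using that G(1) by (auto simp: L_def)
qed

section \<open>Zeros and their multiplicities\<close>

lemma zorder_eq_exponent:
  assumes "open S" "z \<in> S" "\<psi> holomorphic_on S" "\<psi> z \<noteq> 0"
    and "\<And>w. w \<in> S \<Longrightarrow> \<phi> w = (w - z) ^ N * \<psi> w"
  shows "zorder \<phi> z = int N"
  by (rule zorder_eqI[OF assms(1-4)]) (simp add: assms(5) mult.commute)

lemma zorder_factor:
  assumes V: "open V" "connected V" "z \<in> V" and c: "c holomorphic_on V" and \<psi>: "\<psi> holomorphic_on V"
    and eq: "\<And>w. w \<in> V \<Longrightarrow> \<phi> w = c w * \<psi> w" and u: "u \<in> V" "\<phi> u \<noteq> 0"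
  shows "zorder \<phi> z = zorder c z + zorder \<psi> z" and "0 \<le> zorder \<psi> z" and "c z = 0 \<Longrightarrow> 0 < zorder c z"
proof -
  have nz: "c u * \<psi> u \<noteq> 0" "\<exists>w\<in>V. c w \<noteq> 0" "\<exists>w\<in>V. \<psi> w \<noteq> 0"
    using eq[OF u(1)] u by auto
  have "(\<lambda>w. c w * \<psi> w) holomorphic_on V"
    by (intro holomorphic_intros c \<psi>)
  from non_zero_neighbour_alt[OF this V u(1) nz(1)]
  have ev: "\<forall>\<^sub>F w in at z. c w * \<psi> w \<noteq> 0"
    by (rule eventually_mono) auto
  have "zorder \<phi> z = zorder (\<lambda>w. c w * \<psi> w) z"
  proof (rule zorder_cong)
    show "\<forall>\<^sub>F w in at z. \<phi> w = c w * \<psi> w"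
      using eventually_at_in_open'[OF V(1,3)] by (rule eventually_mono) (simp add: eq)
  qed simp
  also have "\<dots> = zorder c z + zorder \<psi> z"
    using ev V c \<psi> by (intro zorder_times_analytic) (auto intro: holomorphic_on_imp_analytic_at)
  finally show "zorder \<phi> z = zorder c z + zorder \<psi> z" .
  show "0 \<le> zorder \<psi> z"
    using zorder_exist_zero[OF \<psi> V nz(3)] by (auto split: if_splits)
  show "c z = 0 \<Longrightarrow> 0 < zorder c z"
    using zorder_exist_zero[OF c V nz(2)] by (auto split: if_splits)
qed

text \<open>
Dividing $F$ by $c$ divides $\Phi \circ F$ by $c^2$, which lowers its order at $z$; the order is
finite because $\Phi \circ F$ does not vanish identically.
\<close>

lemma stem_exhaust_factor:
  assumes V: "open V" "connected V" "z \<in> V" and c: "c holomorphic_on V" "c z = 0"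
    and div: "\<And>F. stem_on V F \<Longrightarrow> F z = 0 \<Longrightarrow> \<exists>G. stem_on V G \<and> (\<forall>w\<in>V. F w = c w *s G w)"
    and F: "stem_on V F" and u: "u \<in> V" "\<Phi> (F u) \<noteq> 0"
  shows "\<exists>m G. stem_on V G \<and> G z \<noteq> 0 \<and> (\<forall>w\<in>V. F w = c w ^ m *s G w)"
  using F u(2)
proof (induction "nat (zorder (\<lambda>w. \<Phi> (F w)) z)" arbitrary: F rule: less_induct)
  case less
  show ?case
  proof (cases "F z = 0")
    case False
    with less.prems show ?thesis
      by (intro exI[of _ 0] exI[of _ F]) simp
  next
    case True
    then obtain G where G: "stem_on V G" "\<And>w. w \<in> V \<Longrightarrow> F w = c w *s G w"
      using div less.prems by blast
    have eq: "\<Phi> (F w) = (c w)\<^sup>2 * \<Phi> (G w)" if "w \<in> V" for w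
      using G(2)[OF that] by (simp add: Phi_scale)
    have "(\<lambda>w. (c w)\<^sup>2) holomorphic_on V"
      by (intro holomorphic_intros c)
    note ord = zorder_factor[OF V this Phi_stem_holomorphic[OF G(1)] eq u(1) less.prems(2)]
    have "nat (zorder (\<lambda>w. \<Phi> (G w)) z) < nat (zorder (\<lambda>w. \<Phi> (F w)) z)"
      using ord c(2) by simp
    moreover have "\<Phi> (G u) \<noteq> 0"
      using eq[OF u(1)] less.prems(2) by auto
    ultimately obtain m H where H: "stem_on V H" "H z \<noteq> 0" "\<And>w. w \<in> V \<Longrightarrow> G w = c w ^ m *s H w"
      using less.hyps[of G] G(1) by blast
    then have "F w = c w ^ Suc m *s H w" if "w \<in> V" for w
      using G(2) that by (simp add: vector_smult_assoc)
    with H show ?thesis by blast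
  qed
qed

lemma parts_cquat_mult:
  "re_part (Z \<diamondop> Y) = re_part Z * re_part Y - im_part Z * im_part Y"
  "im_part (Z \<diamondop> Y) = re_part Z * im_part Y + im_part Z * re_part Y"
  by (simp_all add: re_part_def im_part_def cquat_mult_nth quat_eq_iff)

text \<open>
As long as $\Phi(F(z)) = 0$, the function has a zero $p$ on the sphere of $z$ and a factor $q - p$
splits off on the left, which lowers the order of $\Phi \circ F$ at $z$ by one.
\<close>

lemma linear_factorisation_exists:
  assumes V: "open V" "connected V" "z \<in> V" and "Im z \<noteq> 0"
    and F: "stem_on V F" and f: "\<And>w v. w \<in> V \<Longrightarrow> v \<in> \<S> \<Longrightarrow> f (slice_pt w v) = slice_val (F w) v"
    and u: "u \<in> V" "\<Phi> (F u) \<noteq> 0"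
  shows "\<exists>ps g. set ps \<subseteq> sph {z} \<and> slice_regular V g \<and> is_linear_star_product V ps g f
           \<and> (\<forall>q\<in>sph {z}. g q \<noteq> 0)"
  using F f u(2)
proof (induction "nat (zorder (\<lambda>w. \<Phi> (F w)) z)" arbitrary: F f rule: less_induct)
  case less
  note f_regular = stem_imp_slice_regular_with[OF less.prems(1,2)]
  show ?case
  proof (cases "\<Phi> (F z) = 0")
    case False
    then have "\<forall>q\<in>sph {z}. f q \<noteq> 0"
      using less.prems(2) V(3) by (auto simp: Phi_eq_0_iff sph_def)
    then show ?thesis
      using f_regular by (intro exI[of _ "[]"] exI[of _ f]) (auto simp: slice_regular_def)
  next
    case True
    then obtain v where v: "v \<in> \<S>" "slice_val (F z) v = 0"
      by (auto simp: Phi_eq_0_iff)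
    define p where "p = slice_pt z v"
    have p: "p \<in> sph {z}"
      using v by (auto simp: p_def sph_def)
    obtain G where G: "stem_on V G" "\<And>w. w \<in> V \<Longrightarrow> F w = linear_stem p w \<diamondop> G w"
      using stem_divide_linear[OF less.prems(1) V(3) \<open>Im z \<noteq> 0\<close> v] unfolding p_def by blast
    obtain h where h: "\<And>w v. w \<in> V \<Longrightarrow> v \<in> \<S> \<Longrightarrow> h (slice_pt w v) = slice_val (G w) v"
      using stem_induces_function[OF G(1)] by blast
    have eq: "\<Phi> (F w) = sphere_poly z w * \<Phi> (G w)" if "w \<in> V" for w
      using G(2)[OF that] by (simp add: Phi_mult Phi_linear_stem[OF p])
    note ord = zorder_factor[OF V sphere_poly_holomorphic Phi_stem_holomorphic[OF G(1)] eq u(1) less.prems(3)]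
    have "nat (zorder (\<lambda>w. \<Phi> (G w)) z) < nat (zorder (\<lambda>w. \<Phi> (F w)) z)"
      using ord sphere_poly_root by simp
    moreover have "\<Phi> (G u) \<noteq> 0"
      using eq[OF u(1)] less.prems(3) by auto
    ultimately obtain ps g where ps: "set ps \<subseteq> sph {z}" "slice_regular V g"
        "is_linear_star_product V ps g h" "\<forall>q\<in>sph {z}. g q \<noteq> 0"
      using less.hyps[OF _ G(1) h] by blast
    have lin: "slice_regular_with V (\<lambda>q. q - p) (\<lambda>w. re_part (linear_stem p w)) (\<lambda>w. im_part (linear_stem p w))"
      using F by (intro slice_regular_with_linear) (auto simp: stem_on_def)
    have "is_star_product V (\<lambda>q. q - p) h f"
      unfolding is_star_product_def
      using lin stem_imp_slice_regular_with[OF G(1) h]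
      by (intro exI conjI ballI) (assumption, assumption,
          simp add: less.prems(2) slice_val_def G(2) parts_cquat_mult)
    with ps p show ?thesis
      by (intro exI[of _ "p # ps"] exI[of _ g]) auto
  qed
qed

lemma slice_pt_sphere_poly:
  assumes "v \<in> \<S>"
  shows "slice_pt (sphere_poly z w) v = (slice_pt w v - of_real (Re z))\<^sup>2 + of_real ((Im z)\<^sup>2)"
  unfolding sphere_poly_eq slice_pt_add slice_pt_power[OF assms] slice_pt_diff slice_pt_of_real ..

text \<open>
The power of the spherical polynomial is split off first, until the stem no longer vanishes at $z$;
then the quotient is not identically zero on the sphere, and the linear factors can be split off.
\<close>

lemma sphere_mults_exist:
  assumes V: "open V" "connected V" "z \<in> V" and "Im z \<noteq> 0"
    and f: "slice_regular_with V f \<alpha> \<beta>"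
    and u: "u \<in> V" "\<Phi> (assoc_map \<alpha> \<beta> u) \<noteq> 0"
  shows "\<exists>m n. sphere_mults f z m n"
proof -
  note F = slice_regular_with_imp_stem[OF f]
  have "\<exists>G. stem_on V G \<and> (\<forall>w\<in>V. F w = sphere_poly z w *s G w)" if "stem_on V F" "F z = 0" for F
    using stem_divide_sphere[OF that(1) V(3) that(2) \<open>Im z \<noteq> 0\<close>] by metis
  then obtain m G where G: "stem_on V G" "G z \<noteq> 0"
    "\<And>w. w \<in> V \<Longrightarrow> assoc_map \<alpha> \<beta> w = sphere_poly z w ^ m *s G w"
    using stem_exhaust_factor[OF V sphere_poly_holomorphic sphere_poly_root _ F(1) u] by blast
  obtain f' where f': "\<And>w v. w \<in> V \<Longrightarrow> v \<in> \<S> \<Longrightarrow> f' (slice_pt w v) = slice_val (G w) v"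
    using stem_induces_function[OF G(1)] by blast
  have "\<Phi> (G u) \<noteq> 0"
    using G(3)[OF u(1)] u(2) by (auto simp: Phi_scale)
  then obtain ps g where ps: "set ps \<subseteq> sph {z}" "slice_regular V g"
      "is_linear_star_product V ps g f'" "\<forall>q\<in>sph {z}. g q \<noteq> 0"
    using linear_factorisation_exists[OF V \<open>Im z \<noteq> 0\<close> G(1) f' u(1)] by blast
  have "f q = ((q - of_real (Re z))\<^sup>2 + of_real ((Im z)\<^sup>2)) ^ m * f' q" if q: "q \<in> sph V" for q
  proof -
    obtain w v where w: "w \<in> V" "v \<in> \<S>" "q = slice_pt w v"
      using q by (auto simp: sph_def)
    then show ?thesis
      by (simp add: F(2) f' G(3) slice_val_scale slice_pt_power slice_pt_sphere_poly)
  qed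
  moreover have "\<exists>q\<in>sph {z}. f' q \<noteq> 0"
  proof (rule ccontr)
    assume "\<not> ?thesis"
    then have "slice_val (G z) v = slice_val 0 v" if "v \<in> \<S>" for v
      using f'[OF V(3) that] that
      by (auto simp: sph_def slice_val_def re_part_def im_part_def quat_eq_iff)
    with G(2) show False
      using slice_val_inject by blast
  qed
  moreover have "slice_regular V f'"
    using stem_imp_slice_regular_with[OF G(1) f'] by (auto simp: slice_regular_def)
  ultimately have "sphere_mults f z m (length ps)"
    unfolding sphere_mults_def using ps V(3) \<open>Im z \<noteq> 0\<close> by blast
  then show ?thesis by blast
qed

lemma stem_real_point:
  assumes "stem_on W F" "of_real x \<in> W"
  shows "im_part (F (of_real x)) = 0"
proof -
  have "cnj (F (of_real x) $ l) = F (of_real x) $ l" for l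
    using stem_on_cnj[OF assms, of l] by simp
  then show ?thesis
    by (simp add: im_part_def quat_eq_iff complex_eq_iff)
qed

text \<open>
At a real point the stem is real, so its evaluations at all imaginary units coincide with the value
of $f$.
\<close>

lemma slice_function_at_real:
  assumes "slice_regular_with W f \<alpha> \<beta>" "of_real x \<in> W"
  shows "f (of_real x) = 0 \<longleftrightarrow> \<Phi> (assoc_map \<alpha> \<beta> (of_real x)) = 0"
proof -
  note F = slice_regular_with_imp_stem[OF assms(1)]
  have "f (of_real x) = slice_val (assoc_map \<alpha> \<beta> (of_real x)) v" if "v \<in> \<S>" for v
    using F(2)[OF assms(2) that] by simp
  moreover have "slice_val (assoc_map \<alpha> \<beta> (of_real x)) v = \<alpha> (of_real x)" for v
    using stem_real_point[OF F(1) assms(2)] by (simp add: slice_val_assoc_map)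
  ultimately show ?thesis
    using unit_imag_nonempty by (auto simp: Phi_eq_0_iff)
qed

lemma real_zero_mult_exists:
  assumes V: "open V" "connected V" "of_real x \<in> V"
    and f: "slice_regular_with V f \<alpha> \<beta>"
    and u: "u \<in> V" "\<Phi> (assoc_map \<alpha> \<beta> u) \<noteq> 0"
  shows "\<exists>n. real_zero_mult f x n"
proof -
  note F = slice_regular_with_imp_stem[OF f]
  have "\<exists>G. stem_on V G \<and> (\<forall>w\<in>V. F w = (w - of_real x) *s G w)"
    if "stem_on V F" "F (of_real x) = 0" for F
    using stem_divide_real[OF that] by metis
  moreover have "(\<lambda>w. w - of_real x) holomorphic_on V"
    by (intro holomorphic_intros)
  ultimately obtain n G where G: "stem_on V G" "G (of_real x) \<noteq> 0"
    "\<And>w. w \<in> V \<Longrightarrow> assoc_map \<alpha> \<beta> w = (w - of_real x) ^ n *s G w"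
    using stem_exhaust_factor[OF V, of "\<lambda>w. w - of_real x", OF _ _ _ F(1) u] by force
  obtain g where g: "\<And>w v. w \<in> V \<Longrightarrow> v \<in> \<S> \<Longrightarrow> g (slice_pt w v) = slice_val (G w) v"
    using stem_induces_function[OF G(1)] by blast
  have "g (of_real x) = re_part (G (of_real x))"
    using g[OF V(3) unit_imag_nonempty] stem_real_point[OF G(1) V(3)] by (simp add: slice_val_def)
  moreover have "re_part (G (of_real x)) \<noteq> 0"
    using G(2) stem_real_point[OF G(1) V(3)]
    by (auto simp: re_part_def im_part_def quat_eq_iff vec_eq_iff forall_4 complex_eq_iff)
  moreover have "f q = (q - of_real x) ^ n * g q" if q: "q \<in> sph V" for q
  proof -
    obtain w v where w: "w \<in> V" "v \<in> \<S>" "q = slice_pt w v"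
      using q by (auto simp: sph_def)
    then show ?thesis
      by (simp add: F(2) g G(3) slice_val_scale slice_pt_power slice_pt_diff)
  qed
  moreover have "slice_regular V g"
    using stem_imp_slice_regular_with[OF G(1) g] by (auto simp: slice_regular_def)
  ultimately have "real_zero_mult f x n"
    unfolding real_zero_mult_def using V(3) by (intro exI[of _ V] exI[of _ g]) simp
  then show ?thesis by blast
qed

text \<open>
A real linear factor $w - x$ enters the stem as a scalar, hence it enters $\Phi$ squared.
\<close>

lemma real_zero_mult_zorder:
  assumes f: "slice_regular_with V f \<alpha> \<beta>" and x: "of_real x \<in> V" and mult: "real_zero_mult f x n"
  shows "zorder (\<lambda>w. \<Phi> (assoc_map \<alpha> \<beta> w)) (of_real x) = 2 * int n"
proof -
  obtain W g \<gamma> \<delta> where W: "of_real x \<in> W" and g: "slice_regular_with W g \<gamma> \<delta>"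
    and gx: "g (of_real x) \<noteq> 0" and fg: "\<And>q. q \<in> sph W \<Longrightarrow> f q = (q - of_real x) ^ n * g q"
    using mult by (auto simp: real_zero_mult_def slice_regular_def)
  note F = slice_regular_with_imp_stem[OF f] and G = slice_regular_with_imp_stem[OF g]
  let ?\<psi> = "\<lambda>w. \<Phi> (assoc_map \<gamma> \<delta> w)"
  have "\<Phi> (assoc_map \<alpha> \<beta> w) = (w - of_real x) ^ (2 * n) * ?\<psi> w" if w: "w \<in> V \<inter> W" for w
  proof -
    have "assoc_map \<alpha> \<beta> w = (w - of_real x) ^ n *s assoc_map \<gamma> \<delta> w"
    proof (rule slice_val_inject)
      fix v assume v: "v \<in> \<S>"
      have "slice_val (assoc_map \<alpha> \<beta> w) v = f (slice_pt w v)"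
        using F(2) w v by simp
      also have "\<dots> = (slice_pt w v - of_real x) ^ n * g (slice_pt w v)"
        using w v by (intro fg slice_pt_in_sph) auto
      also have "\<dots> = slice_val ((w - of_real x) ^ n *s assoc_map \<gamma> \<delta> w) v"
        using w v by (simp add: G(2) slice_val_scale slice_pt_power slice_pt_diff)
      finally show "slice_val (assoc_map \<alpha> \<beta> w) v = \<dots>" .
    qed
    then show ?thesis
      by (simp add: Phi_scale power_mult mult.commute[of 2])
  qed
  moreover have "?\<psi> holomorphic_on V \<inter> W"
    using Phi_stem_holomorphic[OF G(1)] by (rule holomorphic_on_subset) simp
  moreover have "open (V \<inter> W)"
    using F(1) G(1) by (auto simp: stem_on_def)
  ultimately have "zorder (\<lambda>w. \<Phi> (assoc_map \<alpha> \<beta> w)) (of_real x) = int (2 * n)"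
    using x W gx slice_function_at_real[OF g W] by (intro zorder_eq_exponent[of "V \<inter> W" _ ?\<psi>]) auto
  then show ?thesis by simp
qed

lemma Phi_linear_star_product:
  assumes "is_linear_star_product W ps g h" "slice_regular_with W g \<gamma> \<delta>" "slice_regular_with W h \<alpha> \<beta>"
    and "set ps \<subseteq> sph {z}" and w: "w \<in> W"
  shows "\<Phi> (assoc_map \<alpha> \<beta> w) = sphere_poly z w ^ length ps * \<Phi> (assoc_map \<gamma> \<delta> w)"
  using assms(1,3,4)
proof (induction ps arbitrary: h \<alpha> \<beta>)
  case Nil
  note G = slice_regular_with_imp_stem[OF assms(2)] and H = slice_regular_with_imp_stem[OF Nil(2)]
  have "assoc_map \<alpha> \<beta> w = assoc_map \<gamma> \<delta> w"
    using Nil(1) G(2)[OF w] H(2)[OF w] slice_pt_in_sph[OF w]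
    by (intro slice_val_inject) (metis is_linear_star_product.simps(1))
  then show ?case by simp
next
  case (Cons p ps)
  then obtain h' where h': "is_linear_star_product W ps g h'" and star: "is_star_product W (\<lambda>q. q - p) h' h"
    by auto
  from star obtain a b c d where ab: "slice_regular_with W (\<lambda>q. q - p) a b"
    and cd: "slice_regular_with W h' c d"
    and h: "\<And>z v. z \<in> W \<Longrightarrow> v \<in> \<S> \<Longrightarrow>
      h (slice_pt z v) = (a z * c z - b z * d z) + v * (a z * d z + b z * c z)"
    unfolding is_star_product_def by blast
  have "assoc_map a b w = linear_stem p w"
    using slice_regular_with_imp_stem(2)[OF ab w]
    by (intro slice_val_inject) (simp add: slice_val_linear_stem)
  moreover have "assoc_map \<alpha> \<beta> w = assoc_map a b w \<diamondop> assoc_map c d w"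
    using slice_regular_with_imp_stem(2)[OF Cons.prems(2) w] h[OF w]
    by (intro slice_val_inject) (simp add: slice_val_def parts_cquat_mult)
  ultimately have "\<Phi> (assoc_map \<alpha> \<beta> w) = sphere_poly z w * \<Phi> (assoc_map c d w)"
    using Cons.prems(3) by (simp add: Phi_mult Phi_linear_stem)
  also have "\<Phi> (assoc_map c d w) = sphere_poly z w ^ length ps * \<Phi> (assoc_map \<gamma> \<delta> w)"
    using Cons.IH[OF h' cd] Cons.prems(3) by simp
  finally show ?case by simp
qed

text \<open>
The spherical polynomial enters the stem as a scalar, hence $\Phi$ squared, whereas each linear
factor contributes the spherical polynomial once.  The cofactor $\Phi \circ G$ does not vanish at
$z$, as $g$ has no zero on the sphere.
\<close>

lemma sphere_mults_zorder:
  assumes f: "slice_regular_with V f \<alpha> \<beta>" and z: "z \<in> V" and mults: "sphere_mults f z m n"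
  shows "zorder (\<lambda>w. \<Phi> (assoc_map \<alpha> \<beta> w)) z = 2 * int m + int n"
    and "zorder (\<lambda>w. \<Phi> (assoc_map \<alpha> \<beta> w)) (cnj z) = 2 * int m + int n"
proof -
  obtain W f' ps g where zW: "z \<in> W" and f': "slice_regular W f'" and g: "slice_regular W g"
    and ff': "\<And>q. q \<in> sph W \<Longrightarrow> f q = ((q - of_real (Re z))\<^sup>2 + of_real ((Im z)\<^sup>2)) ^ m * f' q"
    and ps: "length ps = n" "set ps \<subseteq> sph {z}" "is_linear_star_product W ps g f'"
    and nz: "\<And>q. q \<in> sph {z} \<Longrightarrow> g q \<noteq> 0"
    using mults unfolding sphere_mults_def by blast
  obtain a b \<gamma> \<delta> where ab: "slice_regular_with W f' a b" and gd: "slice_regular_with W g \<gamma> \<delta>"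
    using f' g by (auto simp: slice_regular_def)
  note F = slice_regular_with_imp_stem[OF f] and F' = slice_regular_with_imp_stem[OF ab]
    and G = slice_regular_with_imp_stem[OF gd]
  let ?\<psi> = "\<lambda>w. \<Phi> (assoc_map \<gamma> \<delta> w)" and ?N = "2 * m + n"
  have eq: "\<Phi> (assoc_map \<alpha> \<beta> w) = sphere_poly z w ^ ?N * ?\<psi> w" if w: "w \<in> V \<inter> W" for w
  proof -
    have "assoc_map \<alpha> \<beta> w = sphere_poly z w ^ m *s assoc_map a b w"
    proof (rule slice_val_inject)
      fix v assume v: "v \<in> \<S>"
      have "slice_val (assoc_map \<alpha> \<beta> w) v = f (slice_pt w v)"
        using F(2) w v by simp
      also have "\<dots> = ((slice_pt w v - of_real (Re z))\<^sup>2 + of_real ((Im z)\<^sup>2)) ^ m * f' (slice_pt w v)"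
        using w v by (intro ff' slice_pt_in_sph) auto
      also have "\<dots> = slice_val (sphere_poly z w ^ m *s assoc_map a b w) v"
        using w v by (simp add: F'(2) slice_val_scale slice_pt_power slice_pt_sphere_poly)
      finally show "slice_val (assoc_map \<alpha> \<beta> w) v = \<dots>" .
    qed
    then have "\<Phi> (assoc_map \<alpha> \<beta> w) = sphere_poly z w ^ (2 * m) * \<Phi> (assoc_map a b w)"
      by (simp add: Phi_scale power_mult mult.commute[of 2])
    also have "\<Phi> (assoc_map a b w) = sphere_poly z w ^ n * ?\<psi> w"
      using Phi_linear_star_product[OF ps(3) gd ab ps(2)] w ps(1) by simp
    finally show ?thesis
      by (simp add: power_add)
  qed
  have hol: "?\<psi> holomorphic_on V \<inter> W"
    using Phi_stem_holomorphic[OF G(1)] by (rule holomorphic_on_subset) simp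
  have VW: "open (V \<inter> W)" "z \<in> V \<inter> W" "cnj z \<in> V \<inter> W"
    using F(1) G(1) z zW by (auto simp: stem_on_def conj_invariant_def)
  have "?\<psi> z \<noteq> 0"
    using nz[OF slice_pt_in_sph[OF singletonI]] G(2)[OF zW] by (auto simp: Phi_eq_0_iff)
  then have \<psi>: "?\<psi> z \<noteq> 0" "?\<psi> (cnj z) \<noteq> 0"
    using Phi_stem_cnj[OF G(1) zW] by auto
  have zc: "z - cnj z \<noteq> 0" "cnj z - z \<noteq> 0"
    using mults by (auto simp: sphere_mults_def complex_eq_iff)
  have "zorder (\<lambda>w. \<Phi> (assoc_map \<alpha> \<beta> w)) z = int ?N"
  proof (rule zorder_eq_exponent[OF VW(1,2)])
    show "(\<lambda>w. (w - cnj z) ^ ?N * ?\<psi> w) holomorphic_on V \<inter> W"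
      by (intro holomorphic_intros hol)
  qed (use \<psi> zc eq in \<open>auto simp: sphere_poly_def power_mult_distrib\<close>)
  then show "zorder (\<lambda>w. \<Phi> (assoc_map \<alpha> \<beta> w)) z = 2 * int m + int n"
    by simp
  have "zorder (\<lambda>w. \<Phi> (assoc_map \<alpha> \<beta> w)) (cnj z) = int ?N"
  proof (rule zorder_eq_exponent[OF VW(1,3)])
    show "(\<lambda>w. (w - z) ^ ?N * ?\<psi> w) holomorphic_on V \<inter> W"
      by (intro holomorphic_intros hol)
  qed (use \<psi> zc eq in \<open>auto simp: sphere_poly_def power_mult_distrib\<close>)
  then show "zorder (\<lambda>w. \<Phi> (assoc_map \<alpha> \<beta> w)) (cnj z) = 2 * int m + int n"
    by simp
qed

section \<open>The weighted number of zeros\<close>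

text \<open>
The zeros off the real axis come in conjugate pairs, each represented by its upper member.
\<close>

lemma zero_count_symmetric:
  assumes U: "conj_invariant U" and fin: "finite {z \<in> U. \<phi> z = 0}"
    and sym: "\<And>z. z \<in> U \<Longrightarrow> \<phi> (cnj z) = cnj (\<phi> z)"
  defines "R \<equiv> {x. of_real x \<in> U \<and> \<phi> (of_real x) = 0}" and "P \<equiv> {z \<in> U. Im z > 0 \<and> \<phi> z = 0}"
  shows "finite R" and "finite P"
    and "zero_count \<phi> U = (\<Sum>x\<in>R. zorder \<phi> (of_real x)) + (\<Sum>z\<in>P. zorder \<phi> z + zorder \<phi> (cnj z))"
proof -
  let ?Z = "{z \<in> U. \<phi> z = 0}"
  have "of_real ` R \<subseteq> ?Z" "P \<subseteq> ?Z"
    by (auto simp: R_def P_def)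
  with fin show finR: "finite R" and finP: "finite P"
    by (auto dest: finite_subset intro: finite_imageD[of "of_real :: real \<Rightarrow> complex"] simp: inj_on_def)
  have Z: "?Z = of_real ` R \<union> (P \<union> cnj ` P)"
  proof
    show "?Z \<subseteq> of_real ` R \<union> (P \<union> cnj ` P)"
    proof
      fix z assume z: "z \<in> ?Z"
      consider "Im z = 0" | "Im z > 0" | "Im z < 0" by linarith
      then show "z \<in> of_real ` R \<union> (P \<union> cnj ` P)"
      proof cases
        case 1
        then have "z = of_real (Re z)" by (simp add: complex_eq_iff)
        with z have "Re z \<in> R" by (simp add: R_def)
        with \<open>z = of_real (Re z)\<close> show ?thesis by blast
      next
        case 2
        with z show ?thesis by (simp add: P_def)
      next
        case 3
        with z U sym have "cnj z \<in> P" by (simp add: P_def conj_invariant_def)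
        then show ?thesis by (metis complex_cnj_cnj image_eqI UnCI)
      qed
    qed
    show "of_real ` R \<union> (P \<union> cnj ` P) \<subseteq> ?Z"
      using U sym by (auto simp: R_def P_def conj_invariant_def)
  qed
  have disj: "of_real ` R \<inter> (P \<union> cnj ` P) = {}" "P \<inter> cnj ` P = {}"
    by (auto simp: P_def complex_eq_iff)
  have "zero_count \<phi> U = (\<Sum>z\<in>of_real ` R. zorder \<phi> z) + ((\<Sum>z\<in>P. zorder \<phi> z) + (\<Sum>z\<in>cnj ` P. zorder \<phi> z))"
    unfolding zero_count_def Z
    using finR finP disj by (simp add: sum.union_disjoint)
  also have "(\<Sum>z\<in>of_real ` R. zorder \<phi> z) = (\<Sum>x\<in>R. zorder \<phi> (of_real x))"
    by (subst sum.reindex) (auto simp: inj_on_def)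
  also have "(\<Sum>z\<in>cnj ` P. zorder \<phi> z) = (\<Sum>z\<in>P. zorder \<phi> (cnj z))"
    by (subst sum.reindex) (auto simp: inj_on_def)
  finally show "zero_count \<phi> U = (\<Sum>x\<in>R. zorder \<phi> (of_real x)) + (\<Sum>z\<in>P. zorder \<phi> z + zorder \<phi> (cnj z))"
    by (simp add: sum.distrib)
qed

text \<open>
Each real zero of multiplicity $\rho$ contributes $2\rho$ to the count, and each sphere contributes
$2\mu + \nu$ at its point in the upper half plane and again at the conjugate point.
\<close>

lemma weighted_number_zero_count:
  assumes V: "open V" "connected V" and U: "conj_invariant U" "U \<subseteq> V"
    and f: "slice_regular_with V f \<alpha> \<beta>"
    and u: "u \<in> V" "\<Phi> (assoc_map \<alpha> \<beta> u) \<noteq> 0"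
    and fin: "finite {z \<in> U. \<Phi> (assoc_map \<alpha> \<beta> z) = 0}"
  shows "\<exists>k. has_weighted_number U f k"
    and "has_weighted_number U f k \<Longrightarrow> 2 * int k = zero_count (\<lambda>z. \<Phi> (assoc_map \<alpha> \<beta> z)) U"
proof -
  let ?\<phi> = "\<lambda>z. \<Phi> (assoc_map \<alpha> \<beta> z)"
  note F = slice_regular_with_imp_stem[OF f]
  have R: "real_zeros U f = {x. of_real x \<in> U \<and> ?\<phi> (of_real x) = 0}"
    using slice_function_at_real[OF f] U(2) by (auto simp: real_zeros_def)
  have P: "zero_spheres U f = {z \<in> U. Im z > 0 \<and> ?\<phi> z = 0}"
    using F(2) U(2) by (fastforce simp: zero_spheres_def Phi_eq_0_iff sph_def)
  have sym: "?\<phi> (cnj z) = cnj (?\<phi> z)" if "z \<in> U" for z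
    using Phi_stem_cnj[OF F(1)] that U(2) by auto
  note count = zero_count_symmetric[of U ?\<phi>, OF U(1) fin sym, folded R P]
  have "\<forall>x\<in>real_zeros U f. \<exists>n. real_zero_mult f x n"
    using real_zero_mult_exists[OF V _ f u] U(2) by (auto simp: real_zeros_def)
  moreover have "\<forall>z\<in>zero_spheres U f. \<exists>m n. sphere_mults f z m n"
    using sphere_mults_exist[OF V _ _ f u] U(2) by (auto simp: zero_spheres_def)
  ultimately obtain \<rho> \<mu> \<nu> where
    "\<forall>x\<in>real_zeros U f. real_zero_mult f x (\<rho> x)"
    "\<forall>z\<in>zero_spheres U f. sphere_mults f z (\<mu> z) (\<nu> z)"
    by metis
  then show "\<exists>k. has_weighted_number U f k"
    unfolding has_weighted_number_def using count(1,2) by blast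
  assume "has_weighted_number U f k"
  then obtain \<rho> \<mu> \<nu> where
    mult: "\<And>x. x \<in> real_zeros U f \<Longrightarrow> real_zero_mult f x (\<rho> x)"
      "\<And>z. z \<in> zero_spheres U f \<Longrightarrow> sphere_mults f z (\<mu> z) (\<nu> z)"
    and k: "k = ((\<Sum>x\<in>real_zeros U f. \<rho> x) + (\<Sum>z\<in>zero_spheres U f. \<nu> z))
            + 2 * (\<Sum>z\<in>zero_spheres U f. \<mu> z)"
    unfolding has_weighted_number_def by blast
  have "zero_count ?\<phi> U = (\<Sum>x\<in>real_zeros U f. zorder ?\<phi> (of_real x))
      + (\<Sum>z\<in>zero_spheres U f. zorder ?\<phi> z + zorder ?\<phi> (cnj z))"
    by (rule count(3))
  also have "(\<Sum>x\<in>real_zeros U f. zorder ?\<phi> (of_real x)) = (\<Sum>x\<in>real_zeros U f. 2 * int (\<rho> x))"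
    using U(2) by (intro sum.cong refl real_zero_mult_zorder[OF f _ mult(1)]) (auto simp: real_zeros_def)
  also have "(\<Sum>z\<in>zero_spheres U f. zorder ?\<phi> z + zorder ?\<phi> (cnj z))
      = (\<Sum>z\<in>zero_spheres U f. 2 * (2 * int (\<mu> z) + int (\<nu> z)))"
  proof (rule sum.cong[OF refl])
    fix z assume z: "z \<in> zero_spheres U f"
    then have "z \<in> V" using U(2) by (auto simp: zero_spheres_def)
    from sphere_mults_zorder[OF f this mult(2)[OF z]]
    show "zorder ?\<phi> z + zorder ?\<phi> (cnj z) = 2 * (2 * int (\<mu> z) + int (\<nu> z))" by simp
  qed
  also have "(\<Sum>x\<in>real_zeros U f. 2 * int (\<rho> x)) + (\<Sum>z\<in>zero_spheres U f. 2 * (2 * int (\<mu> z) + int (\<nu> z)))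
      = 2 * int k"
    by (simp add: k sum.distrib sum_distrib_left algebra_simps)
  finally show "2 * int k = zero_count ?\<phi> U" by simp
qed

text \<open>
The slice through one imaginary unit embeds the plane, and a point of it that lies on a sphere of
$V$ belongs to $V$ itself or is conjugate to a point of $V$.
\<close>

lemma closure_sph_subset_imp:
  assumes V: "conj_invariant V" and sub: "closure (sph U) \<subseteq> sph V"
  shows "closure U \<subseteq> V"
proof
  fix z assume z: "z \<in> closure U"
  let ?i = "Quat 0 1 0 0"
  have "continuous_on (closure U) (\<lambda>w. slice_pt w ?i)"
    unfolding slice_pt_def by (intro continuous_intros)
  then have "slice_pt z ?i \<in> closure ((\<lambda>w. slice_pt w ?i) ` U)"
    using image_closure_subset[of U "\<lambda>w. slice_pt w ?i" "closure ((\<lambda>w. slice_pt w ?i) ` U)"] z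
      closure_subset by fastforce
  also have "\<dots> \<subseteq> closure (sph U)"
    by (intro closure_mono) (auto intro: slice_pt_in_sph unit_imag_nonempty)
  finally obtain w v where w: "w \<in> V" "v \<in> \<S>" "slice_pt z ?i = slice_pt w v"
    using sub by (auto simp: sph_def)
  from slice_pt_eqD[OF w(3) unit_imag_nonempty w(2)] have "w = z \<or> w = cnj z" by blast
  with w(1) V show "z \<in> V"
    by (auto simp: conj_invariant_def)
qed

theorem theorem4p3:
  fixes U V :: "complex set"
    and f g :: "quat \<Rightarrow> quat"
    and \<alpha> \<beta> \<gamma> \<delta> :: "complex \<Rightarrow> quat"
  assumes "symmetric_domain U" and "bounded U" and "piecewise_C1_boundary U"
    and "symmetric_domain V" and "closure (sph U) \<subseteq> sph V"
    and "slice_regular_with V f \<alpha> \<beta>"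
    and "slice_regular_with V g \<gamma> \<delta>"
    and "\<And>z. z \<in> frontier U \<Longrightarrow>
           cmod (\<Phi> (assoc_map \<alpha> \<beta> z) - \<Phi> (assoc_map \<gamma> \<delta> z))
             < cmod (\<Phi> (assoc_map \<alpha> \<beta> z)) + cmod (\<Phi> (assoc_map \<gamma> \<delta> z))"
  shows "\<exists>N. \<forall>k. (has_weighted_number U f k \<longleftrightarrow> k = N) \<and>
                 (has_weighted_number U g k \<longleftrightarrow> k = N)"
proof -
  let ?\<phi> = "\<lambda>z. \<Phi> (assoc_map \<alpha> \<beta> z)" and ?\<psi> = "\<lambda>z. \<Phi> (assoc_map \<gamma> \<delta> z)"
  have U: "open U" "U \<noteq> {}" "conj_invariant U" and V: "open V" "connected V" "conj_invariant V"
    using assms(1,4) by (auto simp: symmetric_domain_def)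
  have clU: "closure U \<subseteq> V"
    using closure_sph_subset_imp[OF V(3) assms(5)] .
  then have UV: "U \<subseteq> V"
    using closure_subset by blast
  have hol: "?\<phi> holomorphic_on V" "?\<psi> holomorphic_on V"
    using assms(6,7) by (auto intro!: Phi_stem_holomorphic slice_regular_with_imp_stem(1))
  obtain w where w: "w \<in> frontier U"
    using frontier_eq_empty[of U] U(2) assms(2) not_bounded_UNIV by blast
  then have wV: "w \<in> V"
    using clU by (auto simp: frontier_def)
  have nz: "?\<phi> w \<noteq> 0" "?\<psi> w \<noteq> 0"
    using assms(8)[OF w] by auto
  have fin: "finite {z \<in> U. h z = 0}" if "h holomorphic_on V" "h w \<noteq> 0" for h
  proof -
    have "finite {z \<in> closure U. h z = 0}"
      using assms(2) by (intro finite_zeros_compact[OF that(1) V(1,2) _ clU wV that(2)])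
        (simp add: compact_closure)
    then show ?thesis
      by (rule rev_finite_subset) (use closure_subset[of U] in auto)
  qed
  have count: "zero_count ?\<phi> U = zero_count ?\<psi> U"
    using symmetric_rouche[OF hol V(1,2) U(1) assms(2) U(2) clU assms(8)] .
  note f = weighted_number_zero_count[OF V(1,2) U(3) UV assms(6) wV nz(1) fin[OF hol(1) nz(1)]]
    and g = weighted_number_zero_count[OF V(1,2) U(3) UV assms(7) wV nz(2) fin[OF hol(2) nz(2)]]
  obtain N N' where N: "has_weighted_number U f N" and N': "has_weighted_number U g N'"
    using f(1) g(1) by blast
  have "N' = N"
    using f(2)[OF N] g(2)[OF N'] count by simp
  moreover have "k = N" if "has_weighted_number U f k" for k
    using f(2)[OF N] f(2)[OF that] by simp
  moreover have "k = N'" if "has_weighted_number U g k" for k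
    using g(2)[OF N'] g(2)[OF that] by simp
  ultimately show ?thesis
    using N N' by blast
qed

end
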